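(* Let $N\ge 3$ be an integer. Consider closed polygonal curves in $\mathbb{R}^2$ with $N$ corners, i.e. sequences of $N$ distinct points $p_1,\dots,p_N\in\mathbb{R}^2$ together with the $N$ closed straight line-segments $[p_1,p_2],[p_2,p_3],\dots,[p_{N-1},p_N],[p_N,p_1]$, subject to the condition that any two of these line-segments intersect in at most one point. For such a curve, let $R$ be the number of bounded connected components of the complement in $\mathbb{R}^2$ of the union of the $N$ line-segments. Then the maximum of $R$ over all such curves equals $$f(N)=\begin{cases}\tfrac12 N^2-2N+2, & N \text{ even},\\[2pt] \tfrac12 N^2-\tfrac32 N+1, & N \text{ odd}.\end{cases}$$
   Context: Such a closed polygonal curve is a straight-line drawing of the $N$-cycle graph $p_1-p_2-\cdots-p_N-p_1$ in the plane in which line-segments are allowed to cross. The unbounded component of the complement is not counted in $R$. *)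

theory Defs
  imports "HOL-Analysis.Analysis"
begin

definition poly_edge :: "nat \<Rightarrow> (nat \<Rightarrow> real^2) \<Rightarrow> nat \<Rightarrow> (real^2) set" where
  "poly_edge N p i = closed_segment (p i) (p (Suc i mod N))"

definition admissible_polygon :: "nat \<Rightarrow> (nat \<Rightarrow> real^2) \<Rightarrow> bool" where
  "admissible_polygon N p \<longleftrightarrow>
     inj_on p {..<N} \<and>
     (\<forall>i<N. \<forall>j<N. i \<noteq> j \<longrightarrow>
        (\<forall>x y. x \<in> poly_edge N p i \<inter> poly_edge N p j \<and>
               y \<in> poly_edge N p i \<inter> poly_edge N p j \<longrightarrow> x = y))"

definition bounded_regions :: "nat \<Rightarrow> (nat \<Rightarrow> real^2) \<Rightarrow> (real^2) set set" where
  "bounded_regions N p =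
     {C \<in> components (- (\<Union>i<N. poly_edge N p i)). bounded C}"

definition max_regions :: "nat \<Rightarrow> real" where
  "max_regions N = (if even N then (real N)^2 / 2 - 2 * real N + 2
                    else (real N)^2 / 2 - 3 / 2 * real N + 1)"

end

theory Submission
  imports Defs
begin

text \<open>
Identify the plane with \<open>\<complex>\<close>. Adding a segment that starts on a compact path-connected set \<open>K\<close> and
meets it in finitely many points creates one new complementary component per further intersection point:
a pendant piece separates nothing by Janiszewski's theorem, and the two sides of a chord are separated by
the Jordan curve formed by the chord and an arc in \<open>K\<close>. Tracing the polygon edge by edge, the number of
bounded regions is at most \<open>1\<close> plus the number of crossing pairs of half-open edges, with equality if no
point lies on three edges.

An edge crosses at most \<open>N - 3\<close> others, which settles odd \<open>N\<close>. If \<open>N\<close> is even, the line through an edge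
attaining \<open>N - 3\<close> strictly separates the other even corners from the other odd corners, so it is one of
the two inner common tangents of these two sets; hence at most two edges attain \<open>N - 3\<close>.

Equality holds for the star polygon with \<open>N = 2 m + 1\<close> edges tangent to the unit circle and, for even \<open>N\<close>,
for a zigzag between two parallel lines.
\<close>

section \<open>Complementary components and segments\<close>

text \<open>Path-connectedness of the traced part makes the count local: a segment running between
  two separate pieces of \<open>K\<close> would create no region, so the polygon has to be followed
  from corner to corner. Half-open edges keep the bookkeeping exact, since a corner then belongs to
  the edge ending there and not to the one starting there. An edge can cross neither itself nor its
  two neighbours, hence the number \<open>N - 3\<close>. Every crossing is seen from both of its
  edges, so twice the number of regions is at most 2 plus the sum of all crossing numbers; this
  yields the values of \<open>max_regions\<close>. Parity enters because an edge attaining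
  \<open>N - 3\<close> forces the remaining corners to alternate between the sides of its line. For
  even \<open>N\<close> this sorts them by index parity, the same partition for all such edges,
  which therefore compete for the same lines. For odd \<open>N\<close> index parity breaks at the
  closing edge: different edges induce different partitions, and all of them can attain the bound at
  once.\<close>

lemma components_Un_pendant:
  fixes K :: "complex set"
  assumes K: "compact K" and int: "closed_segment a b \<inter> K = {a}"
  shows "finite (components (- (K \<union> closed_segment a b))) = finite (components (- K)) \<and>
    card (components (- (K \<union> closed_segment a b))) = card (components (- K))"
proof -
  let ?S = "closed_segment a b"
  let ?K = "K \<union> ?S"
  have ne: "V - ?S \<noteq> {}" if "V \<in> components (- K)" for V
  proof
    assume "V - ?S = {}"
    then have "V \<subseteq> ?S" by auto
    moreover have "open V" "V \<noteq> {}"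
      using that K open_components compact_imp_closed in_components_nonempty by blast+
    ultimately have "interior ?S \<noteq> {}"
      by (metis interior_maximal subset_empty)
    then show False
      by (simp add: interior_closed_segment_ge2)
  qed
  have eq: "connected_component_set (- ?K) x = connected_component_set (- K) x - ?S"
    if x: "x \<notin> ?K" for x
  proof -
    \<comment> \<open>Janiszewski applies because \<open>K\<close> and the segment intersect in the
      connected set \<open>{a}\<close>: points separated by neither of them are not separated by the
      union.\<close>
    have "connected_component (- ?K) x y" if "connected_component (- K) x y" "y \<notin> ?S" for y
    proof (rule Janiszewski)
      show "connected_component (- ?S) x y"
        using connected_complement_bounded_convex[of ?S] x that
        unfolding connected_component_def by (intro exI[of _ "- ?S"]) (simp add: bounded_closed_segment)
    qed (use K that int in \<open>auto simp: Int_commute\<close>)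
    moreover have "connected_component (- K) x y" if "connected_component (- ?K) x y" for y
      using that connected_component_of_subset[of "-?K" x y "-K"] by auto
    moreover have "y \<notin> ?S" if "connected_component (- ?K) x y" for y
      using that connected_component_in by fastforce
    ultimately show ?thesis by auto
  qed
  have "components (- ?K) = (\<lambda>V. V - ?S) ` components (- K)"
  proof (intro equalityI subsetI)
    fix C assume "C \<in> components (- ?K)"
    then show "C \<in> (\<lambda>V. V - ?S) ` components (- K)"
      using eq by (auto simp: components_def)
  next
    fix C assume "C \<in> (\<lambda>V. V - ?S) ` components (- K)"
    then obtain V where V: "V \<in> components (- K)" "C = V - ?S" by auto
    then obtain x where x: "x \<in> V" "x \<notin> ?S" using ne by auto
    then have "x \<notin> ?K" using V in_components_subset by blast
    moreover have "V = connected_component_set (- K) x"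
      using V x by (metis components_iff connected_component_eq)
    ultimately show "C \<in> components (- ?K)"
      using eq V by (metis ComplI componentsI)
  qed
  moreover have "inj_on (\<lambda>V. V - ?S) (components (- K))"
  proof (rule inj_onI)
    fix V W assume VW: "V \<in> components (- K)" "W \<in> components (- K)" "V - ?S = W - ?S"
    then have "V \<inter> W \<noteq> {}" using ne[of V] by auto
    then show "V = W" using VW components_eq by blast
  qed
  ultimately show ?thesis
    by (metis card_image finite_image_iff)
qed

lemma loop_through_segment:
  fixes K :: "complex set"
  assumes K: "path_connected K" and ab: "a \<in> K" "b \<in> K" "a \<noteq> b"
    and disj: "open_segment a b \<inter> K = {}"
  obtains c where "simple_path c" "pathfinish c = pathstart c"
    "open_segment a b \<subseteq> path_image c" "path_image c \<subseteq> K \<union> closed_segment a b"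
proof -
  obtain g where g: "arc g" "path_image g \<subseteq> K" "pathstart g = a" "pathfinish g = b"
    using path_connected_arcwise K ab by metis
  have "simple_path (g +++ linepath b a)"
  proof (rule simple_path_join_loop)
    show "path_image g \<inter> path_image (linepath b a) \<subseteq> {pathstart g, pathstart (linepath b a)}"
      using g disj by (auto simp: closed_segment_commute[of b a] open_segment_def)
  qed (use g ab in auto)
  moreover have "path_image (g +++ linepath b a) = path_image g \<union> closed_segment a b"
    using g by (simp add: path_image_join closed_segment_commute)
  ultimately show thesis
    using that[of "g +++ linepath b a"] g by (auto simp: open_segment_def)
qed

text \<open>The two sides of a chord are the images of a rectangle whose height at each point of the chord
  is scaled by the distance to \<open>K\<close>; this makes them connected.\<close>

lemma chord_sides:
  fixes K :: "complex set"
  assumes K: "compact K" and ab: "a \<in> K" "b \<in> K" "a \<noteq> b"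
    and disj: "open_segment a b \<inter> K = {}"
  obtains L R where "connected L" "connected R" "L \<noteq> {}" "R \<noteq> {}"
    "L \<inter> (K \<union> closed_segment a b) = {}" "R \<inter> (K \<union> closed_segment a b) = {}"
    "\<And>s. s \<in> open_segment a b \<Longrightarrow> \<exists>r>0. ball s r \<subseteq> open_segment a b \<union> L \<union> R"
    "\<And>U. U \<in> components (- K) \<Longrightarrow> open_segment a b \<subseteq> U \<Longrightarrow> L \<subseteq> U \<and> R \<subseteq> U"
proof -
  \<comment> \<open>\<open>n\<close> is a unit normal of the chord, \<open>s\<close> parametrizes
    the chord, and \<open>Q 1\<close> and \<open>Q (- 1)\<close> are its two sides. The bound
    \<open>t < d x\<close> places each point in the ball about its foot \<open>s x\<close> that
    avoids \<open>K\<close>.\<close>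
  define n where "n = \<i> * (b - a) / of_real (norm (b - a))"
  define s where "s x = a + of_real x * (b - a)" for x :: real
  define d where "d x = infdist (s x) K" for x
  define Q where "Q \<sigma> = {s x + of_real (\<sigma> * t) * n |x t. 0 < x \<and> x < 1 \<and> 0 < t \<and> t < d x}" for \<sigma> :: real
  define l where "l = norm (b - a)"
  have l: "l > 0" using ab by (simp add: l_def)
  have nn: "norm n = 1" using ab by (simp add: n_def norm_divide norm_mult)
  have seg: "open_segment a b = s ` {0<..<1}"
  proof -
    have "(1 - u) *\<^sub>R a + u *\<^sub>R b = s u" for u
      by (simp add: s_def scaleR_conv_of_real algebra_simps)
    then show ?thesis using ab by (auto simp: in_segment)
  qed
  have d0: "d x > 0" if "0 < x" "x < 1" for x
  proof -
    have "s x \<in> open_segment a b" unfolding seg using that by (intro imageI) auto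
    then have "s x \<notin> K" using disj by blast
    then show ?thesis
      using infdist_pos_not_in_closed[of K "s x"] K ab compact_imp_closed unfolding d_def by blast
  qed
  have ds: "dist (s x) (s y) = \<bar>x - y\<bar> * l" for x y
  proof -
    have "s x - s y = of_real (x - y) * (b - a)" by (simp add: s_def algebra_simps)
    then show ?thesis by (simp add: dist_norm norm_mult l_def del: of_real_diff)
  qed
  have conn: "connected (Q \<sigma>)" for \<sigma>
  proof -
    let ?g = "\<lambda>p::real\<times>real. s (fst p) + of_real (\<sigma> * (snd p * d (fst p))) * n"
    have "Q \<sigma> = ?g ` ({0<..<1} \<times> {0<..<1})"
    proof (intro equalityI subsetI)
      fix w assume "w \<in> Q \<sigma>"
      then obtain x t where xt: "w = s x + of_real (\<sigma> * t) * n" "0 < x" "x < 1" "0 < t" "t < d x"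
        unfolding Q_def by auto
      then have "w = ?g (x, t / d x)" by simp
      moreover have "(x, t / d x) \<in> {0<..<1} \<times> {0<..<1}" using xt by auto
      ultimately show "w \<in> ?g ` ({0<..<1} \<times> {0<..<1})" by blast
    next
      fix w assume "w \<in> ?g ` ({0<..<1} \<times> {0<..<1})"
      then obtain x y where "w = s x + of_real (\<sigma> * (y * d x)) * n" "0 < x" "x < 1" "0 < y" "y < 1"
        by auto
      then show "w \<in> Q \<sigma>" unfolding Q_def using d0[of x]
        by (intro CollectI exI[of _ x] exI[of _ "y * d x"]) auto
    qed
    moreover have "continuous_on ({0<..<1} \<times> {0<..<1}) ?g"
      unfolding s_def d_def by (intro continuous_intros)
    moreover have "connected ({0<..<1::real} \<times> {0<..<1::real})"
      by (intro connected_Times connected_Ioo)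
    ultimately show ?thesis by (simp add: connected_continuous_image)
  qed
  have nonempty: "Q \<sigma> \<noteq> {}" for \<sigma>
  proof -
    have "s (1/2) + of_real (\<sigma> * (d (1/2) / 2)) * n \<in> Q \<sigma>"
      unfolding Q_def using d0[of "1/2"]
      by (intro CollectI exI[of _ "1/2"] exI[of _ "d (1/2) / 2"]) auto
    then show ?thesis by blast
  qed
  have close: "\<exists>x. 0 < x \<and> x < 1 \<and> dist (s x) w < d x" if "w \<in> Q \<sigma>" "\<bar>\<sigma>\<bar> = 1" for w \<sigma>
    using that nn unfolding Q_def by (auto simp: dist_norm norm_mult abs_mult simp flip: of_real_mult)
  have ballK: "ball (s x) (d x) \<inter> K = {}" for x
    unfolding d_def using infdist_le[of _ K "s x"] by fastforce
  \<comment> \<open>In the coordinate \<open>(w - a) / (b - a)\<close> the chord lies on the real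
    axis, so a nonzero imaginary part keeps both sides off the chord.\<close>
  have off: "Im ((w - a) / (b - a)) \<noteq> 0" if wQ: "w \<in> Q \<sigma>" "\<bar>\<sigma>\<bar> = 1" for w \<sigma>
  proof -
    obtain x t where xt: "w = s x + of_real (\<sigma> * t) * n" "0 < t"
      using wQ(1) unfolding Q_def by blast
    have "(w - a) / (b - a) = of_real x + of_real (\<sigma> * t / l) * \<i>"
      using ab l by (simp add: xt s_def n_def l_def field_simps)
    then have "Im ((w - a) / (b - a)) = \<sigma> * t / l" by (simp del: of_real_mult of_real_divide)
    then show ?thesis using wQ xt l by auto
  qed
  have onseg: "Im ((w - a) / (b - a)) = 0" if "w \<in> closed_segment a b" for w
  proof -
    obtain u where "w = (1 - u) *\<^sub>R a + u *\<^sub>R b" using \<open>w \<in> closed_segment a b\<close> by (auto simp: in_segment)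
    then have "(w - a) / (b - a) = of_real u"
      using ab by (simp add: scaleR_conv_of_real field_simps)
    then show ?thesis by simp
  qed
  have dis: "Q \<sigma> \<inter> (K \<union> closed_segment a b) = {}" if "\<bar>\<sigma>\<bar> = 1" for \<sigma>
  proof -
    have "w \<notin> K" if "w \<in> Q \<sigma>" for w
      using close[OF that] \<open>\<bar>\<sigma>\<bar> = 1\<close> ballK by (metis IntI empty_iff mem_ball)
    then show ?thesis using off onseg that by blast
  qed
  have sub: "Q \<sigma> \<subseteq> U" if U: "U \<in> components (- K)" "open_segment a b \<subseteq> U" "\<bar>\<sigma>\<bar> = 1" for \<sigma> U
  proof
    fix w assume "w \<in> Q \<sigma>"
    then obtain x where x: "0 < x" "x < 1" "dist (s x) w < d x"
      using close U(3) by blast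
    have "ball (s x) (d x) \<subseteq> U"
    proof (rule components_maximal[OF U(1)])
      have "s x \<in> U" using x seg U(2) by auto
      then show "U \<inter> ball (s x) (d x) \<noteq> {}" using d0 x by (metis IntI centre_in_ball empty_iff)
    qed (use ballK in auto)
    then show "w \<in> U" using x by auto
  qed
  have nbhd: "\<exists>r>0. ball w r \<subseteq> open_segment a b \<union> Q 1 \<union> Q (- 1)" if w: "w \<in> open_segment a b" for w
  proof -
    obtain x0 where x0: "w = s x0" "0 < x0" "x0 < 1" using w seg by auto
    \<comment> \<open>\<open>d\<close> changes by at most the distance between feet, so it exceeds
      \<open>r\<close> at every foot within distance \<open>r\<close> of \<open>w\<close>, while the
      height stays below \<open>r\<close>. As both ends lie in \<open>K\<close>, \<open>d x0\<close>
      is at most the distance of \<open>w\<close> to either end, so these feet lie strictly inside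
      the chord.\<close>
    define r where "r = d x0 / 2"
    have "v \<in> open_segment a b \<union> Q 1 \<union> Q (- 1)" if v: "dist w v < r" for v
    proof -
      define z where "z = (v - a) / (b - a)"
      define x where "x = Re z"
      have vz: "v = a + z * (b - a)" using ab by (simp add: z_def)
      have v_eq: "v = s x + of_real (l * Im z) * n"
      proof -
        have "v = a + (of_real x + \<i> * of_real (Im z)) * (b - a)"
          using vz complex_eq[of z] by (simp add: x_def)
        then have "v = a + of_real x * (b - a) + of_real (Im z) * (\<i> * (b - a))"
          by (simp add: algebra_simps)
        moreover have "of_real (l * Im z) * n = of_real (Im z) * (\<i> * (b - a))"
          using ab by (simp add: n_def l_def)
        ultimately show ?thesis by (simp only: s_def)
      qed
      have "w - v = (of_real x0 - z) * (b - a)"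
        by (simp add: vz x0 s_def algebra_simps)
      then have nz: "norm (of_real x0 - z) * l < r"
        using v by (simp add: dist_norm norm_mult l_def)
      have "\<bar>x0 - x\<bar> \<le> norm (of_real x0 - z)" "\<bar>Im z\<bar> \<le> norm (of_real x0 - z)"
        using abs_Re_le_cmod[of "of_real x0 - z"] abs_Im_le_cmod[of "of_real x0 - z"] by (auto simp: x_def)
      then have x: "\<bar>x0 - x\<bar> * l < r" and im: "\<bar>Im z\<bar> * l < r"
        using nz l by (meson le_less_trans mult_right_mono less_imp_le)+
      have dx: "d x > r"
        using infdist_triangle[of "s x0" K "s x"] x unfolding r_def d_def[symmetric] ds by linarith
      have "s 0 = a" "s 1 = b" by (auto simp: s_def)
      then have "d x0 \<le> x0 * l" "d x0 \<le> (1 - x0) * l"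
        using ds[of x0 0] ds[of x0 1] x0 ab infdist_le[of a K "s x0"] infdist_le[of b K "s x0"]
        by (auto simp: d_def)
      then have "\<bar>x0 - x\<bar> * l < x0 * l" "\<bar>x0 - x\<bar> * l < (1 - x0) * l"
        using x d0[OF x0(2,3)] unfolding r_def by auto
      then have x01: "0 < x" "x < 1" using l by (auto simp: abs_if split: if_splits)
      consider "Im z = 0" | "Im z > 0" | "Im z < 0" by linarith
      then show ?thesis
      proof cases
        case 1
        then show ?thesis using v_eq seg x01 by auto
      next
        case 2
        then have "v \<in> Q 1" unfolding Q_def using v_eq x01 im dx l
          by (intro CollectI exI[of _ x] exI[of _ "l * Im z"]) (auto simp: mult.commute)
        then show ?thesis by blast
      next
        case 3
        then have "v \<in> Q (- 1)" unfolding Q_def using v_eq x01 im dx l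
          by (intro CollectI exI[of _ x] exI[of _ "- (l * Im z)"]) (auto simp: mult.commute mult_pos_neg)
        then show ?thesis by blast
      qed
    qed
    then have "ball w r \<subseteq> open_segment a b \<union> Q 1 \<union> Q (- 1)"
      by (meson mem_ball subsetI)
    moreover have "r > 0" using d0 x0 by (simp add: r_def)
    ultimately show ?thesis by blast
  qed
  show thesis
    by (rule that[of "Q 1" "Q (- 1)"]) (use conn nonempty dis sub nbhd in auto)
qed

text \<open>Only the component \<open>U\<close> containing the open chord changes. It is replaced by
  the two components \<open>CL\<close> and \<open>CR\<close> around the two sides, so the count
  rises by one.\<close>

lemma components_Un_chord:
  fixes K :: "complex set"
  assumes K: "compact K" "path_connected K" and ab: "a \<in> K" "b \<in> K" "a \<noteq> b"
    and disj: "open_segment a b \<inter> K = {}" and fin: "finite (components (- K))"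
  shows "finite (components (- (K \<union> closed_segment a b))) \<and>
    card (components (- (K \<union> closed_segment a b))) = Suc (card (components (- K)))"
proof -
  let ?S = "open_segment a b"
  let ?K = "K \<union> closed_segment a b"
  have KS: "?K = K \<union> ?S" using ab by (auto simp: open_segment_def)
  obtain L R where LR: "connected L" "connected R" "L \<noteq> {}" "R \<noteq> {}"
    "L \<inter> ?K = {}" "R \<inter> ?K = {}"
    and nbhd: "\<And>s. s \<in> ?S \<Longrightarrow> \<exists>r>0. ball s r \<subseteq> ?S \<union> L \<union> R"
    and LRU: "\<And>U. U \<in> components (- K) \<Longrightarrow> ?S \<subseteq> U \<Longrightarrow> L \<subseteq> U \<and> R \<subseteq> U"
    by (rule chord_sides[OF K(1) ab disj]) (rule that)
  have Sne: "?S \<noteq> {}" using ab by simp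
  obtain U where U: "U \<in> components (- K)" "?S \<subseteq> U"
    using exists_component_superset[of ?S "- K"] disj Sne convex_connected[OF convex_open_segment, of a b]
    by (metis disjoint_eq_subset_Compl subset_empty)
  then have sub: "L \<subseteq> U" "R \<subseteq> U" using LRU by auto
  have "closed ?K" using K by (simp add: closed_Un compact_imp_closed)
  then have opC: "open C" if "C \<in> components (- ?K)" for C
    using that open_components by blast
  have opU: "open U" and conU: "connected U" 
    using U K open_components compact_imp_closed in_components_connected by blast+
  obtain p q where pq: "p \<in> L" "q \<in> R" using LR by auto
  define CL where "CL = connected_component_set (- ?K) p"
  define CR where "CR = connected_component_set (- ?K) q"
  have "L \<subseteq> - ?K" "R \<subseteq> - ?K" using LR(5,6) by blast+
  then have CL: "CL \<in> components (- ?K)" "L \<subseteq> CL" and CR: "CR \<in> components (- ?K)" "R \<subseteq> CR"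
    unfolding CL_def CR_def using pq LR(1,2) componentsI connected_component_maximal
    by (metis subsetD)+
  \<comment> \<open>A component inside \<open>U\<close> that touches neither side has no limit point
    on the chord. It would then be open and closed in the connected set \<open>U\<close>, hence all
    of \<open>U\<close>, although \<open>U\<close> contains the chord.\<close>
  have meet: "C \<inter> (L \<union> R) \<noteq> {}" if C: "C \<in> components (- ?K)" "C \<subseteq> U" for C
  proof
    assume emp: "C \<inter> (L \<union> R) = {}"
    have "closedin (top_of_set U) C"
    proof -
      have "U \<inter> closure C \<subseteq> C"
      proof
        fix z assume z: "z \<in> U \<inter> closure C"
        show "z \<in> C"
        proof (cases "z \<in> ?S")
          case True
          then obtain r where r: "r > 0" "ball z r \<subseteq> ?S \<union> L \<union> R" using nbhd by blast
          obtain y where "y \<in> C" "dist y z < r" using z r closure_approachable[of z C] by auto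
          then have "y \<in> ball z r" by (simp add: dist_commute)
          then have "y \<in> ?S \<union> L \<union> R" using r by blast
          moreover have "y \<notin> ?S" using \<open>y \<in> C\<close> C in_components_subset KS by blast
          ultimately show ?thesis using emp \<open>y \<in> C\<close> by auto
        next
          case False
          then have "z \<in> - ?K" using z U in_components_subset[of U] KS by auto
          then have z': "connected_component_set (- ?K) z \<in> components (- ?K)"
            by (simp add: componentsI)
          moreover have "z \<in> connected_component_set (- ?K) z" using \<open>z \<in> - ?K\<close> by simp
          ultimately have "connected_component_set (- ?K) z \<inter> C \<noteq> {}"
            using z opC[OF z'] by (metis IntD2 IntI disjoint_iff open_Int_closure_eq_empty)
          then show ?thesis using z' C components_eq \<open>z \<in> connected_component_set (- ?K) z\<close> by blast
        qed
      qed
      then show ?thesis using C(2) closure_subset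
        by (metis (no_types, lifting) Int_subset_iff closed_closure closedin_closed_Int subset_antisym)
    qed
    moreover have "openin (top_of_set U) C" using opC C opU by (simp add: openin_open_eq)
    ultimately have "C = {} \<or> C = U" using conU by (metis connected_clopen)
    moreover have "C \<noteq> U" using U Sne C in_components_subset KS by blast
    ultimately show False using C in_components_nonempty by blast
  qed
  \<comment> \<open>A common component would be a connected set off the Jordan curve
    \<open>c\<close>. Each chord point is a limit of the inside and of the outside of
    \<open>c\<close>, and near it all points off the curve belong to \<open>L\<close> or
    \<open>R\<close>; so the component would meet both inside and outside.\<close>
  have "CL \<noteq> CR"
  proof
    assume eq: "CL = CR"
    obtain c where c: "simple_path c" "pathfinish c = pathstart c"
      "?S \<subseteq> path_image c" "path_image c \<subseteq> ?K"
      using loop_through_segment[OF K(2) ab disj] .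
    have conCL: "connected CL" "CL \<subseteq> - path_image c"
      using CL c(4) in_components_connected in_components_subset by blast+
    obtain m where m: "m \<in> ?S" using Sne by blast
    obtain r where r: "r > 0" "ball m r \<subseteq> ?S \<union> L \<union> R" using nbhd[OF m] by auto
    let ?I = "inside (path_image c)" and ?O = "outside (path_image c)"
    have J: "open ?I" "open ?O" "?I \<inter> ?O = {}" "?I \<union> ?O = - path_image c"
      "frontier ?I = path_image c" "frontier ?O = path_image c"
      using Jordan_inside_outside[OF c(1,2)] by blast+
    have hit: "CL \<inter> A \<noteq> {}" if A: "frontier A = path_image c" "A \<inter> path_image c = {}" for A
    proof -
      have "m \<in> closure A" using m c A by (auto simp: frontier_def)
      then obtain y where y: "y \<in> A" "dist y m < r"
        using r closure_approachable[of m A] by blast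
      then have "y \<in> ball m r" by (simp add: dist_commute)
      then have "y \<in> L \<union> R" using r y A c(3) by blast
      then show ?thesis using y CL(2) CR(2) eq by blast
    qed
    have ne: "CL \<inter> ?I \<noteq> {}" "CL \<inter> ?O \<noteq> {}"
      using hit[OF J(5) inside_no_overlap] hit[OF J(6) outside_no_overlap] by auto
    have "CL \<subseteq> ?I \<union> ?O" using conCL J(4) by blast
    moreover have "?I \<inter> ?O \<inter> CL = {}" using J(3) by blast
    ultimately show False
      using connectedD[OF conCL(1) J(1,2)] ne by (metis inf_commute)
  qed
  have UCL: "CL \<subseteq> U" "CR \<subseteq> U"
  proof -
    have *: "C \<subseteq> U" if "C \<in> components (- ?K)" "C \<inter> U \<noteq> {}" for C
      using components_maximal[OF U(1), of C] that in_components_connected[of C] in_components_subset[of C]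
      by blast
    show "CL \<subseteq> U" "CR \<subseteq> U"
      using *[OF CL(1)] *[OF CR(1)] CL(2) CR(2) sub pq by blast+
  qed
  have keep: "V \<in> components (- ?K)" if "V \<in> components (- K)" "V \<noteq> U" for V
  proof (rule components_intermediate_subset[OF that(1)])
    have "V \<inter> U = {}" using that U components_nonoverlap by blast
    then show "V \<subseteq> - ?K" using that in_components_subset[of V] U KS by auto
  qed auto
  have eq: "components (- ?K) = insert CL (insert CR (components (- K) - {U}))"
  proof (intro equalityI subsetI)
    fix C assume C: "C \<in> components (- ?K)"
    then have "C \<subseteq> - K" "connected C" "C \<noteq> {}"
      using in_components_connected in_components_subset in_components_nonempty by blast+
    then obtain V where V: "V \<in> components (- K)" "C \<subseteq> V"
      using exists_component_superset[of C "- K"] in_components_nonempty[OF C]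
      by (metis subset_empty)
    show "C \<in> insert CL (insert CR (components (- K) - {U}))"
    proof (cases "V = U")
      case True
      then have "C \<inter> (L \<union> R) \<noteq> {}" using meet C V by blast
      then have "C \<inter> CL \<noteq> {} \<or> C \<inter> CR \<noteq> {}" using CL CR by blast
      then show ?thesis using C CL CR components_eq by blast
    next
      case False
      then have "C = V" using keep V C \<open>C \<noteq> {}\<close> components_eq by blast
      then show ?thesis using V False by auto
    qed
  qed (use CL CR keep in auto)
  have "CL \<notin> components (- K) - {U}" "CR \<notin> components (- K) - {U}"
    using UCL U CL(1) CR(1) components_nonoverlap in_components_nonempty
    by (metis DiffE inf.absorb_iff1 insertCI)+
  then show ?thesis
    using eq fin \<open>CL \<noteq> CR\<close> card_Suc_Diff1[OF fin U(1)] by (simp add: card_insert_if)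
qed

text \<open>Cut the segment at the point \<open>q\<close> of \<open>K\<close> that is nearest to
  \<open>a\<close> apart from \<open>a\<close> itself: the first piece is a chord, and the rest
  starts on the enlarged set with one hit fewer. If there is no such point, the segment is
  pendant.\<close>

lemma components_Un_segment:
  fixes K :: "complex set"
  assumes "compact K" "path_connected K" "a \<in> K" "finite (closed_segment a b \<inter> K)"
    and "finite (components (- K))"
  shows "finite (components (- (K \<union> closed_segment a b))) \<and>
    card (components (- (K \<union> closed_segment a b))) =
      card (components (- K)) + card (closed_segment a b \<inter> K - {a})"
  using assms
proof (induction "card (closed_segment a b \<inter> K - {a})" arbitrary: K a)
  case 0
  then have "closed_segment a b \<inter> K - {a} = {}" by (metis card_0_eq finite_Diff)
  then have "closed_segment a b \<inter> K = {a}" using \<open>a \<in> K\<close> by auto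
  then show ?case
    using components_Un_pendant[OF 0(2), of a b] 0 by simp
next
  case (Suc n)
  define F where "F = closed_segment a b \<inter> K - {a}"
  have F: "finite F" "card F = Suc n" using Suc by (auto simp: F_def)
  then have "F \<noteq> {}" by auto
  then obtain q where q: "q \<in> F" "\<And>y. y \<in> F \<Longrightarrow> dist a q \<le> dist a y"
    using arg_min_if_finite[OF F(1), of "dist a"] by (metis not_le)
  then have qs: "q \<in> closed_segment a b" "q \<in> K" "q \<noteq> a" by (auto simp: F_def)
  have Un: "closed_segment a q \<union> closed_segment q b = closed_segment a b"
    using Un_closed_segment[OF qs(1)] .
  have Int: "closed_segment a q \<inter> closed_segment q b = {q}"
    using Int_closed_segment[of q a b] qs(1) by blast
  have disj: "open_segment a q \<inter> K = {}"
  proof -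
    have False if y: "y \<in> open_segment a q" "y \<in> K" for y
    proof -
      have "y \<in> F" using y Un by (auto simp: F_def open_segment_def)
      moreover have "dist a y < dist a q"
        using dist_in_open_segment[OF y(1)] by (simp add: dist_commute)
      ultimately show False using q(2) by fastforce
    qed
    then show ?thesis by blast
  qed
  define K1 where "K1 = K \<union> closed_segment a q"
  have K1: "compact K1" "path_connected K1" "q \<in> K1"
    using Suc.prems unfolding K1_def
    by (auto intro!: compact_Un path_connected_Un)
  have c1: "finite (components (- K1))" "card (components (- K1)) = Suc (card (components (- K)))"
    using components_Un_chord[OF Suc.prems(1-3) qs(2) _ disj Suc.prems(5)] qs(3)
    unfolding K1_def by auto
  \<comment> \<open>The new piece meets the rest of the segment only at \<open>q\<close>, so
    enlarging \<open>K\<close> to \<open>K1\<close> creates no additional hits.\<close>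
  have eq: "closed_segment q b \<inter> K1 - {q} = F - {q}"
  proof (intro equalityI subsetI)
    fix y assume y: "y \<in> closed_segment q b \<inter> K1 - {q}"
    then have "y \<in> K" using Int unfolding K1_def by blast
    moreover have "y \<noteq> a" using Int y qs by auto
    ultimately show "y \<in> F - {q}" using y Un unfolding F_def by blast
  next
    fix y assume y: "y \<in> F - {q}"
    then have "y \<notin> closed_segment a q" using disj by (auto simp: F_def open_segment_def)
    then show "y \<in> closed_segment q b \<inter> K1 - {q}"
      using y Un by (auto simp: F_def K1_def)
  qed
  have fin: "finite (closed_segment q b \<inter> K1)"
  proof -
    have "finite (closed_segment q b \<inter> K1 - {q})" using eq F(1) by simp
    then show ?thesis by simp
  qed
  have card: "card (closed_segment q b \<inter> K1 - {q}) = n"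
    using eq F q(1) by simp
  have "K1 \<union> closed_segment q b = K \<union> closed_segment a b"
    using Un by (auto simp: K1_def)
  then show ?case
    using Suc.hyps(1)[OF card[symmetric] K1 fin c1(1)] c1(2) card F unfolding F_def by simp
qed

text \<open>Inserting \<open>z 0\<close> makes stage 0 a single point, whose complement has one
  component; this is the origin of \<open>Suc\<close>. Every later stage is path-connected and
  contains the start of the next segment.\<close>

lemma components_polygonal_path:
  fixes z :: "nat \<Rightarrow> complex"
  defines "K \<equiv> \<lambda>i. insert (z 0) (\<Union>j<i. closed_segment (z j) (z (Suc j)))"
  assumes fin: "\<And>i. i < n \<Longrightarrow> finite (closed_segment (z i) (z (Suc i)) \<inter> K i)"
  shows "finite (components (- K n)) \<and>
    card (components (- K n)) = Suc (\<Sum>i<n. card (closed_segment (z i) (z (Suc i)) \<inter> K i - {z i}))"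
proof -
  have "z i \<in> K i \<and> path_connected (K i) \<and> compact (K i)" for i
  proof (induction i)
    case (Suc i)
    have "K (Suc i) = K i \<union> closed_segment (z i) (z (Suc i))"
      by (auto simp: K_def less_Suc_eq)
    then show ?case using Suc
      by (auto intro!: compact_Un path_connected_Un)
  qed (auto simp: K_def)
  note K = this
  show ?thesis
    using fin
  proof (induction n)
    case 0
    have "connected (- {z 0})"
      by (intro connected_complement_bounded_convex) auto
    then have "components (- {z 0}) = {- {z 0}}"
      by (simp add: components_eq_sing_iff)
         (metis ComplI UNIV_I Compl_eq_Diff_UNIV finite.emptyI finite_insert infinite_UNIV_char_0 insert_Diff_single insert_absorb singleton_iff ex_new_if_finite)
    then show ?case by (simp add: K_def)
  next
    case (Suc n)
    have eq: "K (Suc n) = K n \<union> closed_segment (z n) (z (Suc n))"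
      by (auto simp: K_def less_Suc_eq)
    have "finite (components (- K n))"
      "card (components (- K n)) = Suc (\<Sum>i<n. card (closed_segment (z i) (z (Suc i)) \<inter> K i - {z i}))"
      using Suc by auto
    with components_Un_segment[of "K n" "z n" "z (Suc n)"] K[of n] Suc.prems[of n]
    show ?case unfolding eq by simp
  qed
qed

lemma card_bounded_components:
  fixes K :: "complex set"
  assumes K: "compact K" and fin: "finite (components (- K))"
  shows "card {C \<in> components (- K). bounded C} = card (components (- K)) - 1"
proof -
  have bK: "bounded (- (- K))" using K compact_imp_bounded by simp
  obtain x where x: "x \<in> - K" "\<not> bounded (connected_component_set (- K) x)"
    using cobounded_unbounded_component[OF bK] by auto
  let ?U = "connected_component_set (- K) x"
  have U: "?U \<in> components (- K)" using x by (simp add: componentsI)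
  have "{C \<in> components (- K). bounded C} = components (- K) - {?U}"
    using cobounded_unique_unbounded_components[OF bK U x(2)] x(2) by auto
  then show ?thesis using U fin by simp
qed

section \<open>Counting the regions of a closed polygon\<close>

locale closed_polygon =
  fixes N :: nat and z :: "nat \<Rightarrow> complex"
  assumes N3: "N \<ge> 3"
    and inj: "inj_on z {..<N}"
    and edges_meet_once: "\<And>i j x y. \<lbrakk>i < N; j < N; i \<noteq> j;
      x \<in> closed_segment (z i) (z (Suc i mod N)); x \<in> closed_segment (z j) (z (Suc j mod N));
      y \<in> closed_segment (z i) (z (Suc i mod N)); y \<in> closed_segment (z j) (z (Suc j mod N))\<rbrakk> \<Longrightarrow> x = y"
begin

definition edge :: "nat \<Rightarrow> complex set" where
  "edge i = closed_segment (z i) (z (Suc i mod N))"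

text \<open>Dropping the start corner makes adjacent half-open edges disjoint, while a corner lying
  on a non-adjacent edge still counts as a crossing of its incoming edge.\<close>

definition half_edge :: "nat \<Rightarrow> complex set" where
  "half_edge i = edge i - {z i}"

definition crossings :: "nat \<Rightarrow> nat \<Rightarrow> nat" where
  "crossings i j = card (half_edge i \<inter> half_edge j)"

definition edge_degree :: "nat \<Rightarrow> nat" where
  "edge_degree i = (\<Sum>j\<in>{..<N} - {i}. crossings i j)"

lemma edge_inter_unique:
  "\<lbrakk>i < N; j < N; i \<noteq> j; x \<in> edge i; x \<in> edge j; y \<in> edge i; y \<in> edge j\<rbrakk> \<Longrightarrow> x = y"
  unfolding edge_def by (rule edges_meet_once)

lemma z_eq_iff: "i < N \<Longrightarrow> j < N \<Longrightarrow> z i = z j \<longleftrightarrow> i = j"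
  using inj by (auto simp: inj_on_eq_iff)

lemma Suc_mod_less: "Suc i mod N < N"
  using N3 by simp

lemma Suc_mod_neq: "i < N \<Longrightarrow> Suc i mod N \<noteq> i"
  using N3 by (auto simp: mod_Suc)

lemma corner_in_edge [simp]: "z i \<in> edge i" "z (Suc i mod N) \<in> edge i"
  by (auto simp: edge_def)

lemma corner_in_half_edge: "i < N \<Longrightarrow> z (Suc i mod N) \<in> half_edge i"
  unfolding half_edge_def using z_eq_iff[of "Suc i mod N" i] Suc_mod_neq Suc_mod_less by simp

lemma half_edge_Int_subset:
  assumes "i < N" "j < N" "i \<noteq> j"
  shows "\<exists>x. half_edge i \<inter> half_edge j \<subseteq> edge i \<inter> edge j \<and> edge i \<inter> edge j \<subseteq> {x}"
proof (cases "edge i \<inter> edge j = {}")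
  case False
  then obtain x where "x \<in> edge i" "x \<in> edge j" by auto
  then show ?thesis using edge_inter_unique[OF assms] unfolding half_edge_def by blast
qed (auto simp: half_edge_def)

lemma finite_half_edge_Int:
  assumes "i < N" "j < N" "i \<noteq> j"
  shows "finite (edge i \<inter> edge j)" "finite (half_edge i \<inter> half_edge j)"
  using half_edge_Int_subset[OF assms] by (meson finite.emptyI finite.insertI finite_subset)+

lemma crossings_le_1: "i < N \<Longrightarrow> j < N \<Longrightarrow> i \<noteq> j \<Longrightarrow> crossings i j \<le> 1"
  unfolding crossings_def using half_edge_Int_subset[of i j]
  by (metis card_mono card.empty card_insert_disjoint empty_iff finite.emptyI finite.insertI
      One_nat_def order_trans)

lemma crossings_pos_iff:
  "i < N \<Longrightarrow> j < N \<Longrightarrow> i \<noteq> j \<Longrightarrow> 0 < crossings i j \<longleftrightarrow> half_edge i \<inter> half_edge j \<noteq> {}"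
  unfolding crossings_def using finite_half_edge_Int(2) card_gt_0_iff by blast

lemma crossings_commute: "crossings i j = crossings j i"
  by (simp add: crossings_def Int_commute)

lemma crossings_adjacent:
  assumes "i < N" shows "crossings i (Suc i mod N) = 0"
proof -
  have "half_edge i \<inter> half_edge (Suc i mod N) = {}"
  proof -
    have "x = z (Suc i mod N)" if "x \<in> edge i" "x \<in> edge (Suc i mod N)" for x
      using edge_inter_unique[of i "Suc i mod N" x "z (Suc i mod N)"] that assms
        Suc_mod_less Suc_mod_neq[OF assms] Suc_mod_neq[OF assms, THEN not_sym] by simp
    then show ?thesis unfolding half_edge_def by blast
  qed
  then show ?thesis by (simp add: crossings_def)
qed

section \<open>Tracing the polygon and counting its regions\<close>

definition prefix :: "nat \<Rightarrow> complex set" where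
  "prefix i = insert (z 0) (\<Union>j<i. edge j)"

text \<open>Each omitted start corner is the end of the preceding edge, so only \<open>z 0\<close>
  has to be put back.\<close>

lemma prefix_eq: "i \<le> N \<Longrightarrow> prefix i = insert (z 0) (\<Union>j<i. half_edge j)"
proof (induction i)
  case (Suc i)
  have "prefix (Suc i) = prefix i \<union> edge i" by (auto simp: prefix_def less_Suc_eq)
  also have "\<dots> = insert (z i) (prefix i) \<union> half_edge i" by (auto simp: half_edge_def)
  also have "insert (z i) (prefix i) = prefix i"
  proof (cases i)
    case (Suc k)
    then have "z i \<in> edge k" using corner_in_edge(2)[of k] Suc.prems by simp
    then show ?thesis using Suc by (auto simp: prefix_def)
  qed (simp add: prefix_def)
  finally show ?case using Suc by (auto simp: less_Suc_eq)
qed (simp add: prefix_def)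

lemma finite_edge_prefix:
  assumes "i < N" shows "finite (edge i \<inter> prefix i)"
proof -
  have "edge i \<inter> prefix i \<subseteq> insert (z 0) (\<Union>j<i. edge i \<inter> edge j)" by (auto simp: prefix_def)
  moreover have "finite (\<Union>j<i. edge i \<inter> edge j)"
    using finite_half_edge_Int assms by (intro finite_UN_I) auto
  ultimately show ?thesis by (meson finite.insertI finite_subset)
qed

lemma regions_count:
  defines "Rs \<equiv> {C \<in> components (- (\<Union>i<N. edge i)). bounded C}"
  shows "finite Rs" "card Rs = (\<Sum>i<N. card (half_edge i \<inter> prefix i))"
proof -
  \<comment> \<open>Indices modulo \<open>N\<close> turn the closed polygon into a path of
    \<open>N\<close> segments that returns to its start. The one unbounded component later cancels
    the summand \<open>Suc\<close>.\<close>
  let ?w = "\<lambda>i. z (i mod N)"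
  have eq: "closed_segment (?w i) (?w (Suc i)) = edge i" if "i < N" for i
    using that by (simp add: edge_def)
  have pre: "insert (?w 0) (\<Union>j<i. closed_segment (?w j) (?w (Suc j))) = prefix i" if "i \<le> N" for i
    using that eq by (simp add: prefix_def)
  let ?K = "\<lambda>i. insert (?w 0) (\<Union>j<i. closed_segment (?w j) (?w (Suc j)))"
  have fin: "finite (closed_segment (?w i) (?w (Suc i)) \<inter> ?K i)" if "i < N" for i
    unfolding eq[OF that] pre[OF less_imp_le[OF that]] by (rule finite_edge_prefix[OF that])
  have "finite (components (- ?K N)) \<and>
      card (components (- ?K N)) = Suc (\<Sum>i<N. card (closed_segment (?w i) (?w (Suc i)) \<inter> ?K i - {?w i}))"
    by (rule components_polygonal_path[OF fin])
  also have "(\<Sum>i<N. card (closed_segment (?w i) (?w (Suc i)) \<inter> ?K i - {?w i})) =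
    (\<Sum>i<N. card (edge i \<inter> prefix i - {z i}))"
    by (intro sum.cong refl, subst eq, simp, subst pre) auto
  finally have "finite (components (- prefix N)) \<and>
    card (components (- prefix N)) = Suc (\<Sum>i<N. card (edge i \<inter> prefix i - {z i}))"
    unfolding pre[OF order_refl] .
  moreover have "(\<Sum>i<N. card (edge i \<inter> prefix i - {z i})) = (\<Sum>i<N. card (half_edge i \<inter> prefix i))"
    by (intro sum.cong arg_cong[where f = card]) (auto simp: half_edge_def)
  moreover have "prefix N = (\<Union>i<N. edge i)"
    using N3 corner_in_edge(1)[of 0] unfolding prefix_def by (intro insert_absorb UN_I[of 0]) auto
  moreover have "compact (\<Union>i<N. edge i)" by (auto simp: edge_def)
  ultimately show "finite Rs" "card Rs = (\<Sum>i<N. card (half_edge i \<inter> prefix i))"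
    using card_bounded_components[of "\<Union>i<N. edge i"] unfolding Rs_def by auto
qed

lemma sum_crossings: "2 * (\<Sum>i<N. \<Sum>j<i. crossings i j) = (\<Sum>i<N. edge_degree i)"
proof -
  have "(\<Sum>i<N. edge_degree i) = (\<Sum>i<N. (\<Sum>j<i. crossings i j) + (\<Sum>j\<in>{i<..<N}. crossings i j))"
  proof (intro sum.cong refl)
    fix i assume "i \<in> {..<N}"
    then have "{..<N} - {i} = {..<i} \<union> {i<..<N}" by auto
    then have "edge_degree i = sum (crossings i) ({..<i} \<union> {i<..<N})"
      by (simp only: edge_degree_def)
    also have "\<dots> = (\<Sum>j<i. crossings i j) + (\<Sum>j\<in>{i<..<N}. crossings i j)"
      by (rule sum.union_disjoint) auto
    finally show "edge_degree i = (\<Sum>j<i. crossings i j) + (\<Sum>j\<in>{i<..<N}. crossings i j)" .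
  qed
  also have "\<dots> = (\<Sum>i<N. \<Sum>j<i. crossings i j) + (\<Sum>i<N. \<Sum>j\<in>{i<..<N}. crossings i j)"
    by (rule sum.distrib)
  also have "(\<Sum>i<N. \<Sum>j\<in>{i<..<N}. crossings i j) = (\<Sum>i<N. \<Sum>j\<in>{j. j \<in> {..<N} \<and> i < j}. crossings i j)"
    by (intro sum.cong) auto
  also have "\<dots> = (\<Sum>j<N. \<Sum>i\<in>{i. i \<in> {..<N} \<and> i < j}. crossings i j)"
    by (rule sum.swap_restrict) auto
  also have "\<dots> = (\<Sum>j<N. \<Sum>i<j. crossings i j)"
    by (intro sum.cong) auto
  also have "\<dots> = (\<Sum>i<N. \<Sum>j<i. crossings i j)"
    by (simp add: crossings_commute)
  finally show ?thesis by simp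
qed

lemma start_in_last: "z 0 \<in> half_edge (N - 1)"
  using corner_in_half_edge[of "N - 1"] N3 by simp

text \<open>The start point \<open>z 0\<close> is counted at the last edge; if an intermediate half-open edge passes
  through it, that hit is paid for by the crossing of this edge with the last one.\<close>

lemma regions_le:
  "(\<Sum>i<N. card (half_edge i \<inter> prefix i)) \<le> 1 + (\<Sum>i<N. \<Sum>j<i. crossings i j)"
proof -
  obtain M where SM: "Suc M = N" using N3 by (cases N) auto
  have M: "M < N" "\<And>i. i < M \<Longrightarrow> i < N" "M = N - 1" using SM by auto
  have split: "sum f {..<N} = sum f {..<M} + f M" for f :: "nat \<Rightarrow> nat"
    unfolding SM[symmetric] by simp
  have fin: "finite (half_edge i \<inter> half_edge j)" if "i < N" "j < i" for i j
    using finite_half_edge_Int(2)[of i j] that by simp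
  have 1: "card (half_edge i \<inter> prefix i) \<le> card (half_edge i \<inter> {z 0}) + (\<Sum>j<i. crossings i j)"
    if "i < M" for i
  proof -
    have "half_edge i \<inter> prefix i = (half_edge i \<inter> {z 0}) \<union> (\<Union>j<i. half_edge i \<inter> half_edge j)"
      using that M by (subst prefix_eq) auto
    also have "card \<dots> \<le> card (half_edge i \<inter> {z 0}) + card (\<Union>j<i. half_edge i \<inter> half_edge j)"
      by (rule card_Un_le)
    also have "card (\<Union>j<i. half_edge i \<inter> half_edge j) \<le> (\<Sum>j<i. crossings i j)"
      unfolding crossings_def by (rule card_UN_le) simp
    finally show ?thesis by simp
  qed
  have z0: "z 0 \<in> half_edge M" using start_in_last M(3) by simp
  have 2: "card (half_edge M \<inter> prefix M) + (\<Sum>j<M. card (half_edge j \<inter> {z 0})) \<le> 1 + (\<Sum>j<M. crossings M j)"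
  proof -
    have "half_edge M \<inter> prefix M \<subseteq> insert (z 0) (\<Union>j<M. half_edge M \<inter> half_edge j - {z 0})"
      using M by (subst prefix_eq) auto
    moreover have "finite (\<Union>j<M. half_edge M \<inter> half_edge j - {z 0})"
      using fin M by (intro finite_UN_I finite_Diff) auto
    ultimately have "card (half_edge M \<inter> prefix M) \<le>
        card (insert (z 0) (\<Union>j<M. half_edge M \<inter> half_edge j - {z 0}))"
      by (intro card_mono) auto
    also have "\<dots> \<le> Suc (card (\<Union>j<M. half_edge M \<inter> half_edge j - {z 0}))"
      by (rule card_insert_le_m1) auto
    also have "card (\<Union>j<M. half_edge M \<inter> half_edge j - {z 0}) \<le> (\<Sum>j<M. card (half_edge M \<inter> half_edge j - {z 0}))"
      by (rule card_UN_le) simp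
    finally have "card (half_edge M \<inter> prefix M) \<le> Suc (\<Sum>j<M. card (half_edge M \<inter> half_edge j - {z 0}))"
      by simp
    moreover have "(\<Sum>j<M. card (half_edge M \<inter> half_edge j - {z 0})) + (\<Sum>j<M. card (half_edge j \<inter> {z 0}))
      = (\<Sum>j<M. crossings M j)"
      unfolding sum.distrib[symmetric] crossings_def
    proof (intro sum.cong refl)
      fix j assume "j \<in> {..<M}"
      then have f: "finite (half_edge M \<inter> half_edge j)" using fin[of M j] M by simp
      show "card (half_edge M \<inter> half_edge j - {z 0}) + card (half_edge j \<inter> {z 0}) = card (half_edge M \<inter> half_edge j)"
      proof (cases "z 0 \<in> half_edge j")
        case True
        then have "card (half_edge j \<inter> {z 0}) = 1" by simp
        moreover have "z 0 \<in> half_edge M \<inter> half_edge j" using True z0 by simp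
        ultimately show ?thesis using f card_Suc_Diff1[OF f] by simp
      qed simp
    qed
    ultimately show ?thesis by simp
  qed
  have "(\<Sum>i<N. card (half_edge i \<inter> prefix i)) \<le>
    (\<Sum>i<M. card (half_edge i \<inter> {z 0}) + (\<Sum>j<i. crossings i j)) + card (half_edge M \<inter> prefix M)"
    unfolding split by (intro add_right_mono sum_mono 1) auto
  also have "\<dots> \<le> 1 + (\<Sum>i<N. \<Sum>j<i. crossings i j)"
    using 2 unfolding split by (simp add: sum.distrib)
  finally show ?thesis .
qed

definition no_triple_points :: bool where
  "no_triple_points \<longleftrightarrow> (\<forall>i<N. \<forall>j<N. \<forall>k<N. i \<noteq> j \<longrightarrow> j \<noteq> k \<longrightarrow> i \<noteq> k \<longrightarrow>
     edge i \<inter> edge j \<inter> edge k = {})"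

lemma no_triple_pointsD:
  "\<lbrakk>no_triple_points; i < N; j < N; k < N; i \<noteq> j; j \<noteq> k; i \<noteq> k; x \<in> edge i; x \<in> edge j\<rbrakk> \<Longrightarrow> x \<notin> edge k"
  unfolding no_triple_points_def by blast

text \<open>Without triple points the crossings on one half-open edge are distinct points, so no
  hits are lost in the unions. On the last edge \<open>z 0\<close> is an extra hit: another
  half-open edge through it would be concurrent with the last edge and edge 0.\<close>

lemma regions_ge:
  assumes no_triple_points
  shows "1 + (\<Sum>i<N. \<Sum>j<i. crossings i j) \<le> (\<Sum>i<N. card (half_edge i \<inter> prefix i))"
proof -
  note triple = no_triple_pointsD[OF assms]
  obtain M where SM: "Suc M = N" using N3 by (cases N) auto
  have M: "M < N" "\<And>i. i < M \<Longrightarrow> i < N" "M = N - 1" using SM by auto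
  have split: "sum f {..<N} = sum f {..<M} + f M" for f :: "nat \<Rightarrow> nat"
    unfolding SM[symmetric] by simp
  have fin: "finite (half_edge i \<inter> half_edge j)" if "i < N" "j < i" for i j
    using finite_half_edge_Int(2)[of i j] that by simp
  have finp: "finite (half_edge i \<inter> prefix i)" if "i < N" for i
    using finite_edge_prefix[OF that] by (rule finite_subset[rotated]) (auto simp: half_edge_def)
  have card: "card (\<Union>j<i. half_edge i \<inter> half_edge j) = (\<Sum>j<i. crossings i j)" if "i < N" for i
    unfolding crossings_def
  proof (rule card_UN_disjoint)
    show "\<forall>j\<in>{..<i}. \<forall>k\<in>{..<i}. j \<noteq> k \<longrightarrow>
        half_edge i \<inter> half_edge j \<inter> (half_edge i \<inter> half_edge k) = {}"
    proof (intro ballI impI)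
      fix j k assume "j \<in> {..<i}" "k \<in> {..<i}" "j \<noteq> k"
      then show "half_edge i \<inter> half_edge j \<inter> (half_edge i \<inter> half_edge k) = {}"
        using triple[of i j k] that by (auto simp: half_edge_def)
    qed
  qed (use fin that in auto)
  have sub: "(\<Union>j<i. half_edge i \<inter> half_edge j) \<subseteq> half_edge i \<inter> prefix i" if "i < N" for i
    using that by (subst prefix_eq) auto
  have 1: "(\<Sum>j<i. crossings i j) \<le> card (half_edge i \<inter> prefix i)" if "i < N" for i
    unfolding card[OF that, symmetric] using sub finp that by (intro card_mono) auto
  have "z 0 \<notin> (\<Union>j<M. half_edge M \<inter> half_edge j)"
  proof
    assume "z 0 \<in> (\<Union>j<M. half_edge M \<inter> half_edge j)"
    then obtain j where j: "j < M" "z 0 \<in> half_edge j" by auto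
    then have "j \<noteq> 0" by (metis DiffD2 half_edge_def insertI1)
    moreover have "z 0 \<in> edge M" using start_in_last M(3) by (simp add: half_edge_def)
    moreover have "z 0 \<in> edge j" using j by (simp add: half_edge_def)
    ultimately show False using triple[of 0 M j "z 0"] j(1) M(1,2) by auto
  qed
  moreover have "insert (z 0) (\<Union>j<M. half_edge M \<inter> half_edge j) \<subseteq> half_edge M \<inter> prefix M"
    using sub[OF M(1)] start_in_last M(3) by (auto simp: prefix_def)
  then have "card (insert (z 0) (\<Union>j<M. half_edge M \<inter> half_edge j)) \<le> card (half_edge M \<inter> prefix M)"
    using finp[of M] M by (intro card_mono) auto
  moreover have "finite (\<Union>j<M. half_edge M \<inter> half_edge j)"
    using fin[OF M(1)] by blast
  ultimately have 2: "Suc (\<Sum>j<M. crossings M j) \<le> card (half_edge M \<inter> prefix M)"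
    unfolding card[OF M(1), symmetric] by (metis card_insert_disjoint)
  show ?thesis
    unfolding split using sum_mono[of "{..<M}", OF 1] M(2) 2 by fastforce
qed

end

section \<open>Edges with the maximal number of crossings\<close>

text \<open>Twice the signed area of the triangle \<open>a b c\<close>; the sign tells on which side
  of the directed line from \<open>a\<close> to \<open>b\<close> the point \<open>c\<close>
  lies.\<close>

definition orient :: "complex \<Rightarrow> complex \<Rightarrow> complex \<Rightarrow> real" where
  "orient a b c = Im (cnj (b - a) * (c - a))"

lemma orient_swap: "orient b a c = - orient a b c"
  by (simp add: orient_def algebra_simps)

lemma orient_swap2: "orient a c b = - orient a b c"
  by (simp add: orient_def algebra_simps)

text \<open>The two diagonals of the quadrilateral \<open>a b c d\<close> cut it into triangles with
  the same total signed area.\<close>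

lemma orient_four_points: "orient b c d - orient a c d + orient a b d - orient a b c = 0"
  by (simp add: orient_def algebra_simps)

lemma orient_affine:
  "orient a b ((1 - t) *\<^sub>R c + t *\<^sub>R d) = (1 - t) * orient a b c + t * orient a b d"
  by (simp add: orient_def algebra_simps)

lemma orient_segment_zero: "x \<in> closed_segment a b \<Longrightarrow> orient a b x = 0"
  by (auto simp: in_segment orient_affine) (simp add: orient_def algebra_simps)

lemma orient_zero_imp_scaled:
  assumes "a \<noteq> b" "orient a b c = 0" "orient a b d = 0"
  shows "\<exists>r::real. c - d = r *\<^sub>R (b - a)"
proof -
  have "orient a b c - orient a b d = Im (cnj (b - a) * (c - d))"
    by (simp add: orient_def algebra_simps)
  then have "Im (cnj (b - a) * (c - d)) = 0" using assms by simp
  then obtain s :: real where s: "cnj (b - a) * (c - d) = of_real s"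
    by (metis complex_is_Real_iff Reals_cases)
  have "(b - a) * cnj (b - a) = of_real ((norm (b - a))\<^sup>2)"
    using complex_norm_square[of "b - a"] by simp
  then have "of_real ((norm (b - a))\<^sup>2) * (c - d) = of_real s * (b - a)"
    using s by (metis mult.assoc mult.commute)
  moreover have "norm (b - a) \<noteq> 0" using assms by simp
  ultimately have "c - d = (s / (norm (b - a))\<^sup>2) *\<^sub>R (b - a)"
    by (simp add: scaleR_conv_of_real field_simps)
  then show ?thesis by blast
qed

text \<open>\<open>orient a b\<close> vanishes at \<open>x\<close>, a proper convex combination of
  \<open>c\<close> and \<open>d\<close>. Its values at \<open>c\<close> and \<open>d\<close> are
  therefore opposite in sign or both zero, and in the latter case the segments would overlap in more
  than \<open>x\<close>.\<close>

lemma segment_separates_ends: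
  assumes x: "x \<in> closed_segment a b" "x \<in> closed_segment c d" "x \<noteq> c" "x \<noteq> d" and ab: "a \<noteq> b"
    and unique: "\<And>y. y \<in> closed_segment a b \<Longrightarrow> y \<in> closed_segment c d \<Longrightarrow> y = x"
    and c: "c \<notin> closed_segment a b"
  shows "orient a b c * orient a b d < 0"
proof -
  obtain t where t: "x = (1 - t) *\<^sub>R c + t *\<^sub>R d" "0 \<le> t" "t \<le> 1"
    using x by (auto simp: in_segment)
  then have t01: "0 < t" "t < 1" using x by (auto simp: less_le)
  have 0: "(1 - t) * orient a b c + t * orient a b d = 0"
    using orient_segment_zero[OF x(1)] t by (simp add: orient_affine)
  have "orient a b c \<noteq> 0"
  proof
    assume c0: "orient a b c = 0"
    then have d0: "orient a b d = 0" using 0 t01 by simp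
    have cd: "c \<noteq> d" using t(1) x(3) by (auto simp: algebra_simps)
    \<comment> \<open>All points are now collinear, so the overlap can be found by moving from
      \<open>x\<close> towards an end \<open>e\<close> of the first segment other than
      \<open>x\<close>.\<close>
    define e where "e = (if x = a then b else a)"
    have e: "e \<noteq> x" "e \<in> closed_segment a b" using ab by (auto simp: e_def)
    have "orient c d e = 0" "orient c d x = 0"
    proof -
      obtain r where "d - c = r *\<^sub>R (b - a)" using orient_zero_imp_scaled[OF ab d0 c0] by blast
      moreover obtain r' where "e - c = r' *\<^sub>R (b - a)"
        using orient_zero_imp_scaled[OF ab orient_segment_zero[OF e(2)] c0] by blast
      ultimately show "orient c d e = 0"
        by (simp add: orient_def) (simp add: algebra_simps)
      show "orient c d x = 0" using orient_segment_zero x(2) by blast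
    qed
    then obtain r where r: "e - x = r *\<^sub>R (d - c)" using orient_zero_imp_scaled[OF cd] by blast
    \<comment> \<open>Small enough for the shift \<open>\<epsilon> * r\<close> to keep the parameter
      \<open>t\<close> of the second segment within \<open>[0, 1]\<close>.\<close>
    define \<epsilon> where "\<epsilon> = min 1 (min t (1 - t) / (\<bar>r\<bar> + 1))"
    have \<epsilon>: "0 < \<epsilon>" "\<epsilon> \<le> 1" using t01 by (auto simp: \<epsilon>_def)
    have "\<epsilon> * \<bar>r\<bar> \<le> min t (1 - t)"
    proof -
      have "\<epsilon> * \<bar>r\<bar> \<le> \<epsilon> * (\<bar>r\<bar> + 1)" using \<epsilon> by simp
      also have "\<dots> \<le> min t (1 - t) / (\<bar>r\<bar> + 1) * (\<bar>r\<bar> + 1)"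
        by (intro mult_right_mono) (auto simp: \<epsilon>_def)
      finally show ?thesis by simp
    qed
    then have er: "\<bar>\<epsilon> * r\<bar> \<le> t" "\<bar>\<epsilon> * r\<bar> \<le> 1 - t" using \<epsilon> by (auto simp: abs_mult)
    define y where "y = (1 - \<epsilon>) *\<^sub>R x + \<epsilon> *\<^sub>R e"
    have "y \<in> closed_segment x e" using \<epsilon> by (auto simp: y_def in_segment intro!: exI[of _ \<epsilon>])
    then have "y \<in> closed_segment a b" using x(1) e(2) closed_segment_subset[of x "closed_segment a b" e] by auto
    moreover have "y = (1 - (t + \<epsilon> * r)) *\<^sub>R c + (t + \<epsilon> * r) *\<^sub>R d"
    proof -
      have "y = x + \<epsilon> *\<^sub>R (e - x)" by (simp add: y_def algebra_simps)
      then show ?thesis unfolding r by (simp add: t(1) algebra_simps)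
    qed
    then have "y \<in> closed_segment c d" using er by (auto simp: in_segment intro!: exI[of _ "t + \<epsilon> * r"])
    ultimately have "y = x" by (rule unique)
    then have "\<epsilon> *\<^sub>R (e - x) = 0" by (simp add: y_def algebra_simps)
    then show False using \<epsilon> e by simp
  qed
  moreover have "t * orient a b d = - ((1 - t) * orient a b c)" using 0 by simp
  then have "orient a b d = - ((1 - t) / t * orient a b c)" using t01 by (simp add: field_simps)
  then have "orient a b c * orient a b d = - ((1 - t) / t * (orient a b c)\<^sup>2)"
    by (simp add: power2_eq_square)
  ultimately show ?thesis using t01 by simp
qed

text \<open>A line through \<open>z a\<close> and \<open>z b\<close> separating the even from the odd points is one of the two
  inner common tangents of their convex hulls; the sign \<open>\<tau>\<close> tells which one.\<close>

definition separating_pair :: "nat \<Rightarrow> (nat \<Rightarrow> complex) \<Rightarrow> real \<Rightarrow> nat \<Rightarrow> nat \<Rightarrow> bool" where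
  "separating_pair N z \<tau> a b \<longleftrightarrow> a < N \<and> b < N \<and> even a \<and> odd b \<and>
    (\<forall>k<N. k \<noteq> a \<longrightarrow> k \<noteq> b \<longrightarrow> \<tau> * (- 1) ^ k * orient (z a) (z b) (z k) > 0)"

text \<open>If the two pairs have no common point, the sign conditions make all four terms of
  \<open>orient_four_points\<close>, multiplied by \<open>\<tau>\<close>, negative, although they
  add up to 0. If they share one point, both conditions concern the same triangle with opposite
  orientations.\<close>

lemma separating_pair_unique:
  assumes P: "separating_pair N z \<tau> a b" and Q: "separating_pair N z \<tau> c d"
  shows "a = c \<and> b = d"
proof -
  have ne: "a \<noteq> d" "b \<noteq> c" "a \<noteq> b" "c \<noteq> d" using P Q by (auto simp: separating_pair_def)
  have Pc: "\<tau> * orient (z a) (z b) (z c) > 0" if "a \<noteq> c"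
    using P Q that ne unfolding separating_pair_def by (metis even_power mult.right_neutral neg_one_even_power)
  have Pd: "\<tau> * orient (z a) (z b) (z d) < 0" if "b \<noteq> d"
  proof -
    have "\<tau> * (- 1) ^ d * orient (z a) (z b) (z d) > 0" using P Q that ne unfolding separating_pair_def by blast
    then show ?thesis using Q by (simp add: separating_pair_def)
  qed
  have Qa: "\<tau> * orient (z c) (z d) (z a) > 0" if "a \<noteq> c"
    using P Q that ne unfolding separating_pair_def by (metis even_power mult.right_neutral neg_one_even_power)
  have Qb: "\<tau> * orient (z c) (z d) (z b) < 0" if "b \<noteq> d"
  proof -
    have "\<tau> * (- 1) ^ b * orient (z c) (z d) (z b) > 0" using P Q that ne unfolding separating_pair_def by metis
    then show ?thesis using P by (simp add: separating_pair_def)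
  qed
  consider "a = c" "b = d" | "a = c" "b \<noteq> d" | "a \<noteq> c" "b = d" | "a \<noteq> c" "b \<noteq> d" by blast
  then show ?thesis
  proof cases
    case 2
    then show ?thesis using Pd Qb orient_swap2[of "z a" "z d" "z b"] by simp
  next
    case 3
    have "orient (z c) (z b) (z a) = - orient (z a) (z b) (z c)"
      by (simp add: orient_def algebra_simps)
    then show ?thesis using 3 Pc Qa by simp
  next
    case 4
    have "orient (z b) (z c) (z d) = orient (z c) (z d) (z b)"
      "orient (z a) (z c) (z d) = orient (z c) (z d) (z a)"
      by (simp_all add: orient_def algebra_simps)
    then have "\<tau> * orient (z c) (z d) (z b) - \<tau> * orient (z c) (z d) (z a)
        + \<tau> * orient (z a) (z b) (z d) - \<tau> * orient (z a) (z b) (z c) = 0"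
      using orient_four_points[of "z b" "z c" "z d" "z a"]
      by (metis (no_types, opaque_lifting) mult_zero_right right_diff_distrib distrib_left)
    then show ?thesis using Pc Pd Qa Qb 4 by linarith
  qed simp
qed

section \<open>Edges that cross all non-adjacent edges\<close>

context closed_polygon
begin

text \<open>The two neighbours contribute 0 and each of the remaining \<open>N - 3\<close> edges at
  most 1, so equality forces every one of the latter to cross.\<close>

lemma edge_degree_le: 
  assumes "i < N"
  shows "edge_degree i \<le> N - 3"
    and "edge_degree i = N - 3 \<Longrightarrow> j < N \<Longrightarrow> j \<noteq> i \<Longrightarrow> Suc i mod N \<noteq> j \<Longrightarrow> Suc j mod N \<noteq> i \<Longrightarrow>
      half_edge i \<inter> half_edge j \<noteq> {}"
proof -
  define p where "p = (if i = 0 then N - 1 else i - 1)"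
  have p: "p < N" "Suc p mod N = i" "p \<noteq> i" "p \<noteq> Suc i mod N"
    using assms N3 by (auto simp: p_def mod_Suc)
  define A where "A = {..<N} - {i, Suc i mod N, p}"
  have "card {i, Suc i mod N, p} = 3" using p Suc_mod_neq[OF assms] by (simp add: card_insert_if)
  then have cA: "card A = N - 3" unfolding A_def
    using assms p(1) Suc_mod_less by (subst card_Diff_subset) auto
  have "edge_degree i = (\<Sum>j\<in>A. crossings i j)"
    unfolding edge_degree_def
  proof (rule sum.mono_neutral_right)
    show "\<forall>j\<in>{..<N} - {i} - A. crossings i j = 0"
      using crossings_adjacent[OF assms] crossings_adjacent[OF p(1)] p(2)
      by (auto simp: A_def crossings_commute)
  qed (auto simp: A_def)
  note deg = this
  have le: "crossings i j \<le> 1" if "j \<in> A" for j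
    using crossings_le_1[of i j] assms that by (auto simp: A_def)
  show "edge_degree i \<le> N - 3"
    using sum_mono[of A "crossings i" "\<lambda>_. 1"] le cA deg by simp
  assume full: "edge_degree i = N - 3" and j: "j < N" "j \<noteq> i" "Suc i mod N \<noteq> j" "Suc j mod N \<noteq> i"
  have jA: "j \<in> A" using j p(2) by (auto simp: A_def)
  have "crossings i j \<noteq> 0"
  proof
    assume "crossings i j = 0"
    then have "(\<Sum>j\<in>A. crossings i j) < (\<Sum>j\<in>A. 1)"
      using le jA by (intro sum_strict_mono_ex1) (auto simp: A_def)
    then show False using deg full cA by simp
  qed
  then show "half_edge i \<inter> half_edge j \<noteq> {}"
    by (auto simp: crossings_def)
qed

text \<open>Such a corner \<open>z k\<close> would be the only common point of edges
  \<open>i\<close> and \<open>k\<close>, but half-open edge \<open>k\<close> omits it, so these two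
  could not cross. If edge \<open>k\<close> precedes edge \<open>i\<close>, their only common point
  is \<open>z i\<close>, which differs from \<open>z k\<close>.\<close>

lemma full_edge_no_corner:
  assumes i: "i < N" and full: "edge_degree i = N - 3"
    and k: "k < N" "k \<noteq> i" "k \<noteq> Suc i mod N"
  shows "z k \<notin> edge i"
proof
  assume zk: "z k \<in> edge i"
  show False
  proof (cases "Suc k mod N = i")
    case True
    then have "z k = z i"
      using edge_inter_unique[of k i "z k" "z i"] zk corner_in_edge[of k] k i by simp
    then show False using z_eq_iff k i by simp
  next
    case False
    then obtain x where x: "x \<in> half_edge i" "x \<in> half_edge k"
      using edge_degree_le(2)[OF i full k(1,2)] k by blast
    then have "x = z k"
      using edge_inter_unique[of k i x "z k"] zk k i by (simp add: half_edge_def)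
    then show False using x by (simp add: half_edge_def)
  qed
qed

lemma full_edge_alternates:
  assumes i: "i < N" and full: "edge_degree i = N - 3"
    and j: "j < N" "j \<noteq> i" "Suc i mod N \<noteq> j" "Suc j mod N \<noteq> i"
  shows "orient (z i) (z (Suc i mod N)) (z j) * orient (z i) (z (Suc i mod N)) (z (Suc j mod N)) < 0"
proof -
  obtain x where x: "x \<in> edge i" "x \<in> edge j"
    using edge_degree_le(2)[OF i full j] by (auto simp: half_edge_def)
  have "Suc j mod N \<noteq> Suc i mod N" using i j(1,2) by (auto simp: mod_Suc split: if_splits)
  then have nc: "z j \<notin> edge i" "z (Suc j mod N) \<notin> edge i"
    using full_edge_no_corner[OF i full] j Suc_mod_less by auto
  show ?thesis
    using segment_separates_ends[of x "z i" "z (Suc i mod N)" "z j" "z (Suc j mod N)"] x nc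
      edge_inter_unique[of i j _ x] i j z_eq_iff[of i "Suc i mod N"] Suc_mod_less Suc_mod_neq[OF i]
    unfolding edge_def[symmetric] by metis
qed

text \<open>For even \<open>N\<close>, reduction modulo \<open>N\<close> preserves index parity, so
  alternation along the remaining corners separates even from odd ones. Taking the even end as
  \<open>a\<close> may reverse the direction of the line; \<open>\<tau>\<close> absorbs the
  sign.\<close>

lemma full_edge_separating:
  assumes "even N" "i < N" "edge_degree i = N - 3"
  shows "\<exists>\<tau>\<in>{1, - 1}. separating_pair N z \<tau> (if even i then i else Suc i mod N) (if even i then Suc i mod N else i)"
proof -
  define a where "a = (if even i then i else Suc i mod N)"
  define b where "b = (if even i then Suc i mod N else i)"
  define o' where "o' k = orient (z a) (z b) (z k)" for k
  have par: "even (m mod N) \<longleftrightarrow> even m" for m using \<open>even N\<close> by (simp add: dvd_mod_iff)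
  have ab: "a < N" "b < N" "even a" "odd b" "{a, b} = {i, Suc i mod N}"
    using assms Suc_mod_less par by (auto simp: a_def b_def)
  have step: "o' j * o' (Suc j mod N) < 0" if "j < N" "j \<noteq> i" "Suc i mod N \<noteq> j" "Suc j mod N \<noteq> i" for j
    using full_edge_alternates[OF assms(2,3) that] orient_swap[of "z i" "z (Suc i mod N)"]
    unfolding o'_def a_def b_def by auto
  \<comment> \<open>The alternating factor turns the changes of side along the corners from
    \<open>i + 2\<close> onwards into a constant sign.\<close>
  define g where "g t = (- 1) ^ t * o' ((i + 2 + t) mod N)" for t :: nat
  have pos: "g 0 * g t > 0" if "t < N - 2" for t
    using that
  proof (induction t)
    case 0
    \<comment> \<open>Corner \<open>i + 2\<close> starts an edge whose ends lie strictly on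
      different sides, unless \<open>N = 3\<close>, which parity excludes.\<close>
    have "g 0 \<noteq> 0 \<or> N = 3"
    proof (cases "N = 3")
      case False
      have "(i + 2) mod N < N" "(i + 2) mod N \<noteq> i" "Suc i mod N \<noteq> (i + 2) mod N"
          "Suc ((i + 2) mod N) mod N \<noteq> i"
        using N3 False assms(2) by (auto simp: mod_Suc mod_if)
      then show ?thesis using step[of "(i + 2) mod N"] by (auto simp: g_def)
    qed simp
    then show ?case using assms(1) by (auto simp: zero_less_mult_iff linorder_neq_iff)
  next
    case (Suc t)
    define j where "j = (i + 2 + t) mod N"
    have j: "Suc j mod N = (i + 2 + Suc t) mod N" by (simp add: j_def mod_Suc_eq)
    have "j < N" "j \<noteq> i" "Suc i mod N \<noteq> j" "Suc j mod N \<noteq> i"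
      using Suc.prems assms(2) N3 unfolding j j_def by (auto simp: mod_if)
    then have "o' j * o' (Suc j mod N) < 0" by (rule step)
    then have "g t * g (Suc t) > 0"
      unfolding g_def j[symmetric] j_def[symmetric]
      by (simp add: mult_ac flip: power_add mult_2 power_mult_distrib)
    moreover have "g 0 * g t > 0" using Suc by simp
    ultimately have "(g 0 * g t) * (g t * g (Suc t)) > 0" by simp
    then have "(g 0 * g (Suc t)) * (g t)\<^sup>2 > 0" by (simp add: power2_eq_square mult_ac)
    then show ?case by (simp add: zero_less_mult_iff)
  qed
  \<comment> \<open>Positions are counted from \<open>i + 2\<close>; the factor
    \<open>(- 1) ^ i\<close> converts their parity into that of the corner index.\<close>
  define \<tau> where "\<tau> = (- 1) ^ i * sgn (g 0)"
  have g0: "g 0 \<noteq> 0" using pos[of 0] N3 by auto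
  have "\<tau> \<in> {1, - 1}" using g0 by (cases "even i") (auto simp: \<tau>_def sgn_if)
  moreover have "\<tau> * (- 1) ^ k * o' k > 0" if k: "k < N" "k \<noteq> a" "k \<noteq> b" for k
  proof -
    have k': "k \<noteq> i" "k \<noteq> Suc i mod N" using k ab(5) by auto
    \<comment> \<open>The number of steps around the cycle from corner \<open>i + 2\<close> to
      corner \<open>k\<close>.\<close>
    define t where "t = (if k \<ge> i + 2 then k - i - 2 else k + N - i - 2)"
    have t: "t < N - 2" "(i + 2 + t) mod N = k"
    proof -
      have "k \<noteq> Suc i" using k' k(1) by auto
      then consider "k \<ge> i + 2" | "k < i" using k'(1) by linarith
      then have "t < N - 2 \<and> (i + 2 + t = k \<or> i + 2 + t = k + N)"
      proof cases
        case 2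
        moreover have "k + N \<ge> i + 2"
          using k' assms(2) by (cases "k = 0 \<and> Suc i = N") auto
        ultimately show ?thesis using k(1) assms(2) N3 by (auto simp: t_def)
      qed (use k(1) in \<open>auto simp: t_def\<close>)
      then show "t < N - 2" "(i + 2 + t) mod N = k" using k(1) by auto
    qed
    have "even (i + 2 + t) \<longleftrightarrow> even k" using t(2) par by metis
    then have "(- 1) ^ k = (- 1) ^ i * (- 1 :: real) ^ t" 
      by (cases "even i"; cases "even t") auto
    then have "\<tau> * (- 1) ^ k * o' k = sgn (g 0) * g t"
      unfolding g_def[of t] t(2) \<tau>_def by (cases "even i") auto
    moreover have "sgn (g 0) * g t > 0"
      using pos[OF t(1)] by (auto simp: sgn_if zero_less_mult_iff)
    ultimately show ?thesis by simp
  qed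
  ultimately show ?thesis
    using ab unfolding separating_pair_def a_def[symmetric] b_def[symmetric] o'_def by blast
qed

lemma card_full_edges:
  assumes "even N"
  shows "card {i. i < N \<and> edge_degree i = N - 3} \<le> 2"
proof -
  let ?F = "{i. i < N \<and> edge_degree i = N - 3}"
  define a where "a i = (if even i then i else Suc i mod N)" for i
  define b where "b i = (if even i then Suc i mod N else i)" for i
  have "\<forall>i\<in>?F. \<exists>\<tau>. \<tau> \<in> {1, - 1} \<and> separating_pair N z \<tau> (a i) (b i)"
    using full_edge_separating[OF assms] unfolding a_def b_def by blast
  then obtain \<tau> where \<tau>: "\<And>i. i \<in> ?F \<Longrightarrow> \<tau> i \<in> {1, - 1} \<and> separating_pair N z (\<tau> i) (a i) (b i)"
    by metis
  \<comment> \<open>Edges with the same sign have the same ends, and a cycle of more than two edges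
    has no two edges with the same ends.\<close>
  have "inj_on \<tau> ?F"
  proof (rule inj_onI)
    fix i j assume ij: "i \<in> ?F" "j \<in> ?F" "\<tau> i = \<tau> j"
    then have "a i = a j \<and> b i = b j" using \<tau>[of i] \<tau>[of j] separating_pair_unique by metis
    moreover have "N \<noteq> 3" using assms by auto
    ultimately show "i = j"
      using ij N3 unfolding a_def b_def by (auto simp: mod_Suc split: if_splits)
  qed
  moreover have "\<tau> ` ?F \<subseteq> {1, - 1}" using \<tau> by auto
  ultimately have "card ?F \<le> card {1, - 1 :: real}" by (intro card_inj_on_le) auto
  then show ?thesis by simp
qed

section \<open>The upper bound\<close>

lemma sum_edge_degree_le_odd: "(\<Sum>i<N. edge_degree i) \<le> N * (N - 3)"
  using sum_mono[of "{..<N}" edge_degree "\<lambda>_. N - 3"] edge_degree_le(1) by simp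

lemma sum_edge_degree_le_even:
  assumes "even N"
  shows "(\<Sum>i<N. edge_degree i) \<le> N * (N - 4) + 2"
proof -
  have N4: "N \<ge> 4" using N3 assms by (cases "N = 3") auto
  let ?F = "{i. i < N \<and> edge_degree i = N - 3}"
  have "(\<Sum>i<N. edge_degree i) \<le> (\<Sum>i<N. (N - 4) + of_bool (i \<in> ?F))"
  proof (rule sum_mono)
    fix i assume "i \<in> {..<N}"
    then show "edge_degree i \<le> (N - 4) + of_bool (i \<in> ?F)"
      using edge_degree_le(1)[of i] N4 by (cases "edge_degree i = N - 3") auto
  qed
  also have "\<dots> = N * (N - 4) + card ?F"
    by (simp add: sum.distrib Int_def)
  finally show ?thesis using card_full_edges[OF assms] by simp
qed

lemma regions_upper_bound:
  defines "Rs \<equiv> {C \<in> components (- (\<Union>i<N. edge i)). bounded C}"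
  shows "real (card Rs) \<le> max_regions N"
proof -
  have "2 * card Rs \<le> 2 + (\<Sum>i<N. edge_degree i)"
    using regions_count(2) regions_le sum_crossings unfolding Rs_def by linarith
  then have R: "2 * real (card Rs) \<le> 2 + real (\<Sum>i<N. edge_degree i)" by linarith
  show ?thesis
  proof (cases "even N")
    case True
    then have "N \<ge> 4" using N3 by (cases "N = 3") auto
    then have "real (N * (N - 4) + 2) = (real N)^2 - 4 * real N + 2"
      by (simp add: of_nat_diff power2_eq_square algebra_simps)
    moreover have "real (\<Sum>i<N. edge_degree i) \<le> real (N * (N - 4) + 2)"
      using sum_edge_degree_le_even[OF True] of_nat_mono by blast
    ultimately show ?thesis using R True by (simp add: max_regions_def)
  next
    case False
    have "real (N * (N - 3)) = (real N)^2 - 3 * real N"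
      using N3 by (simp add: of_nat_diff power2_eq_square algebra_simps)
    moreover have "real (\<Sum>i<N. edge_degree i) \<le> real (N * (N - 3))"
      using sum_edge_degree_le_odd of_nat_mono by blast
    ultimately show ?thesis using R False by (simp add: max_regions_def)
  qed
qed

end

section \<open>Criteria for attaining the bound\<close>

context closed_polygon
begin

lemma regions_lower_bound:
  assumes triple: no_triple_points
  shows "2 + (\<Sum>i<N. edge_degree i) \<le> 2 * card {C \<in> components (- (\<Union>i<N. edge i)). bounded C}"
  using regions_ge[OF triple] sum_crossings unfolding regions_count(2) by linarith

text \<open>\<open>D\<close> collects the edges that edge \<open>i\<close> may miss. Meeting closed
  edges already meet in their half-open parts: a common point at a start corner would also lie on
  the edge ending there, giving a triple point.\<close>

lemma edge_degree_ge:
  assumes triple: no_triple_points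
    and i: "i < N" and D: "finite D"
    and meet: "\<And>j. \<lbrakk>j < N; j \<noteq> i; Suc i mod N \<noteq> j; Suc j mod N \<noteq> i; j \<notin> D\<rbrakk> \<Longrightarrow> edge i \<inter> edge j \<noteq> {}"
  shows "N - 3 - card D \<le> edge_degree i"
proof -
  note triple = no_triple_pointsD[OF triple]
  define p where "p = (if i = 0 then N - 1 else i - 1)"
  have p: "p < N" "Suc p mod N = i" "\<And>q. q < N \<Longrightarrow> Suc q mod N = i \<Longrightarrow> q = p"
    using i N3 by (auto simp: p_def mod_Suc split: if_splits)
  define A where "A = {..<N} - ({i, Suc i mod N, p} \<union> D)"
  have "card ({i, Suc i mod N, p} \<union> D) \<le> 3 + card D"
    using card_Un_le[of "{i, Suc i mod N, p}" D] card_insert_le_m1[of 3 "{Suc i mod N, p}" i]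
      card_insert_le_m1[of 2 "{p}" "Suc i mod N"] by simp
  then have A: "N - 3 - card D \<le> card A"
    using diff_card_le_card_Diff[of "{i, Suc i mod N, p} \<union> D" "{..<N}"] D unfolding A_def by simp
  have "1 \<le> crossings i j" if "j \<in> A" for j
  proof -
    have j: "j < N" "j \<noteq> i" "Suc i mod N \<noteq> j" "Suc j mod N \<noteq> i" "j \<notin> D"
      using that p(3)[of j] by (auto simp: A_def)
    obtain x where x: "x \<in> edge i" "x \<in> edge j" using meet[OF j] by auto
    define q where "q = (if j = 0 then N - 1 else j - 1)"
    have q: "q < N" "Suc q mod N = j" using j N3 by (auto simp: q_def mod_Suc)
    have "p \<noteq> i" "p \<noteq> j" "q \<noteq> i" "q \<noteq> j"
      using p(2) q(2) j(3,4) Suc_mod_neq[OF p(1)] Suc_mod_neq[OF q(1)] by metis+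
    then have "x \<noteq> z i" "x \<noteq> z j"
      using triple[of i j p x] triple[of i j q x] x i j p(1,2) q corner_in_edge(2)[of p] corner_in_edge(2)[of q]
      by auto
    then have "half_edge i \<inter> half_edge j \<noteq> {}" using x by (auto simp: half_edge_def)
    then show ?thesis using crossings_pos_iff[of i j] i j by simp
  qed
  then have "card A \<le> (\<Sum>j\<in>A. crossings i j)"
    using sum_mono[of A "\<lambda>_. 1" "crossings i"] by simp
  also have "\<dots> \<le> edge_degree i"
    unfolding edge_degree_def by (rule sum_mono2) (auto simp: A_def)
  finally show ?thesis using A by simp
qed

lemma regions_maximal:
  assumes triple: no_triple_points
    and deg: "(\<Sum>i<N. edge_degree i) \<ge> (if even N then N * (N - 4) + 2 else N * (N - 3))"
  defines "Rs \<equiv> {C \<in> components (- (\<Union>i<N. edge i)). bounded C}"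
  shows "real (card Rs) = max_regions N"
proof (rule antisym)
  have R: "2 + (\<Sum>i<N. edge_degree i) \<le> 2 * card Rs"
    unfolding Rs_def using triple by (rule regions_lower_bound)
  show "max_regions N \<le> real (card Rs)"
  proof (cases "even N")
    case True
    then have "N \<ge> 4" using N3 by (cases "N = 3") auto
    then have "real (N * (N - 4) + 2) = (real N)^2 - 4 * real N + 2"
      by (simp add: of_nat_diff power2_eq_square algebra_simps)
    moreover have "real (N * (N - 4) + 2 + 2) \<le> real (2 * card Rs)"
      using deg R True by (intro of_nat_mono) simp
    ultimately show ?thesis using True by (simp add: max_regions_def)
  next
    case False
    have "real (N * (N - 3)) = (real N)^2 - 3 * real N"
      using N3 by (simp add: of_nat_diff power2_eq_square algebra_simps)
    moreover have "real (N * (N - 3) + 2) \<le> real (2 * card Rs)"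
      using deg R False by (intro of_nat_mono) simp
    ultimately show ?thesis using False by (simp add: max_regions_def)
  qed
qed (unfold Rs_def, rule regions_upper_bound)

end

text \<open>Coinciding corners would lie on the two edges starting there and on the two edges ending
  there; for \<open>N \<ge> 3\<close> at least three of these are different, which makes a triple
  point.\<close>

lemma closed_polygonI:
  fixes z :: "nat \<Rightarrow> complex"
  assumes N3: "N \<ge> 3"
    and triple: "\<And>i j k x. \<lbrakk>i < N; j < N; k < N; i \<noteq> j; j \<noteq> k; i \<noteq> k;
      x \<in> closed_segment (z i) (z (Suc i mod N)); x \<in> closed_segment (z j) (z (Suc j mod N))\<rbrakk>
      \<Longrightarrow> x \<notin> closed_segment (z k) (z (Suc k mod N))"
    and once: "\<And>i j x y. \<lbrakk>i < N; j < N; i \<noteq> j;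
      x \<in> closed_segment (z i) (z (Suc i mod N)); x \<in> closed_segment (z j) (z (Suc j mod N));
      y \<in> closed_segment (z i) (z (Suc i mod N)); y \<in> closed_segment (z j) (z (Suc j mod N))\<rbrakk> \<Longrightarrow> x = y"
  shows "closed_polygon N z"
proof
  show "inj_on z {..<N}"
  proof (rule inj_onI, rule ccontr)
    fix i j assume ij: "i \<in> {..<N}" "j \<in> {..<N}" "z i = z j" "i \<noteq> j"
    have "\<exists>p<N. Suc p mod N = k \<and> p \<noteq> k" if "k < N" for k
      using that N3 by (intro exI[of _ "if k = 0 then N - 1 else k - 1"]) (auto simp: mod_Suc)
    then obtain p q where p: "p < N" "Suc p mod N = i" "p \<noteq> i" and q: "q < N" "Suc q mod N = j" "q \<noteq> j"
      using ij by (metis lessThan_iff)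
    have inc: "z i \<in> closed_segment (z i) (z (Suc i mod N))" "z i \<in> closed_segment (z j) (z (Suc j mod N))"
      "z i \<in> closed_segment (z p) (z (Suc p mod N))" "z i \<in> closed_segment (z q) (z (Suc q mod N))"
      using ij(3) p(2) q(2) by auto
    have "\<not> (Suc j mod N = i \<and> Suc i mod N = j)"
      using ij(1,2) N3 by (auto simp: mod_Suc split: if_splits)
    then consider "p \<noteq> j" | "q \<noteq> i" using p(2) q(2) by blast
    then show False
      using triple[of i j p "z i"] triple[of i j q "z i"] inc ij p q by cases auto
  qed
qed (use N3 once in blast)+

section \<open>The extremal polygon with an odd number of edges\<close>

text \<open>Points on the tangent to the unit circle at \<open>u\<close> have the form
  \<open>u * Complex 1 s\<close>. The tangents at \<open>u\<close> and
  \<open>u * cis (2 * b)\<close> thus meet at parameter \<open>tan b\<close> of the first and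
  \<open>- tan b\<close> of the second.\<close>

lemma cis_tan:
  assumes "cos b \<noteq> 0"
  shows "cis (2 * b) * Complex 1 (- tan b) = Complex 1 (tan b)"
proof -
  have "of_real (cos b) * (cis (2 * b) * Complex 1 (- tan b)) = of_real (cos b) * Complex 1 (tan b)"
  proof -
    have "of_real (cos b) * Complex 1 (- tan b) = cis (- b)" "of_real (cos b) * Complex 1 (tan b) = cis b"
      using assms by (auto simp: complex_eq_iff tan_def)
    moreover have "cis (2 * b) * cis (- b) = cis b" by (simp add: cis_mult)
    ultimately show ?thesis by (metis mult.left_commute)
  qed
  then show ?thesis using assms by simp
qed

text \<open>The condition \<open>Re (w * cnj t) = 1\<close> says that \<open>w\<close> lies on the
  tangent at \<open>t\<close>, a quadratic equation for the tangent point \<open>t\<close>. Its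
  roots are \<open>u\<close> and \<open>v\<close>, and the conclusion is Vieta's formula for their
  sum. It excludes double and triple incidences alike.\<close>

lemma on_two_tangents:
  fixes u v w :: complex
  assumes "Re (w * cnj u) = 1" "Re (w * cnj v) = 1" "norm u = 1" "norm v = 1" "u \<noteq> v"
  shows "cnj w * (u + v) = 2"
proof -
  have *: "cnj w * t\<^sup>2 - 2 * t + w = 0" if "Re (w * cnj t) = 1" "norm t = 1" for t
  proof -
    have "w * cnj t + cnj w * t = complex_of_real (2 * Re (w * cnj t))"
      using complex_add_cnj[of "w * cnj t"] by (simp only: complex_cnj_mult complex_cnj_cnj)
    then have "w * cnj t + cnj w * t = 2" unfolding that(1) by simp
    moreover have "t * cnj t = 1" using complex_norm_square[of t] that by simp
    moreover have "cnj w * t\<^sup>2 - 2 * t + w = t * (w * cnj t + cnj w * t) - 2 * t + w * (1 - t * cnj t)"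
      by (simp add: algebra_simps power2_eq_square)
    ultimately show ?thesis by simp
  qed
  have "(u - v) * (cnj w * (u + v) - 2) = (cnj w * u\<^sup>2 - 2 * u + w) - (cnj w * v\<^sup>2 - 2 * v + w)"
    by (simp add: algebra_simps power2_eq_square)
  then have "(u - v) * (cnj w * (u + v) - 2) = 0"
    using *[OF assms(1,3)] *[OF assms(2,4)] by simp
  then show ?thesis using assms(5) by simp
qed

text \<open>The tangent points advance by \<open>m / N\<close> of a full turn, just short of a half
  turn. Any two of them differ by a rotation through at most this angle, so each edge, which extends
  to the tangents of its two neighbours, is long enough to reach every other edge.\<close>

lemma odd_polygon:
  fixes m :: nat
  assumes m: "m \<ge> 1"
  defines "N \<equiv> 2 * m + 1"
  shows "\<exists>z. closed_polygon N z \<and>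
    real (card {C \<in> components (- (\<Union>i<N. closed_segment (z i) (z (Suc i mod N)))). bounded C}) =
      max_regions N"
proof -
  define u where "u i = cis (2 * pi * m * i / N)" for i :: nat
  define \<phi> where "\<phi> = pi * m / N"
  have N: "real N = 2 * real m + 1" "N > 0" by (auto simp: N_def)
  have \<phi>: "0 < \<phi>" "\<phi> < pi / 2" using m N by (auto simp: \<phi>_def field_simps)
  then have cos\<phi>: "cos \<phi> > 0" by (intro cos_gt_zero) auto
  \<comment> \<open>Edge \<open>i\<close> is the part of the tangent at \<open>u i\<close> with
    parameter between \<open>- tan \<phi>\<close> and \<open>tan \<phi>\<close>; the ends are its
    intersections with the tangents of the neighbouring edges.\<close>
  define z where z: "z i = u i * Complex 1 (- tan \<phi>)" for i
  have zS: "z (Suc i mod N) = u i * Complex 1 (tan \<phi>)" if "i < N" for i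
  proof -
    have "u (Suc i mod N) = u (Suc i)"
    proof (cases "Suc i = N")
      case True
      have "u N = cis (2 * pi * m)" using N by (simp add: u_def)
      also have "\<dots> = 1" using cis_multiple_2pi[of "real m"] by (simp add: mult.commute mult.left_commute)
      finally show ?thesis using True by (simp add: u_def)
    qed (use that in auto)
    also have "u (Suc i) = u i * cis (2 * \<phi>)"
      unfolding u_def \<phi>_def cis_mult by (simp add: field_simps add_divide_distrib)
    finally show ?thesis using cis_tan[of \<phi>] cos\<phi> by (simp add: z mult.assoc)
  qed
  have normu: "norm (u i) = 1" for i by (simp add: u_def)
  have edge: "closed_segment (z i) (z (Suc i mod N)) = {u i * Complex 1 s |s. \<bar>s\<bar> \<le> tan \<phi>}" if "i < N" for i
  proof -
    have t0: "tan \<phi> > 0" using \<phi> by (intro tan_gt_zero) auto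
    show ?thesis
    proof (intro equalityI subsetI)
      fix w assume "w \<in> closed_segment (z i) (z (Suc i mod N))"
      then obtain t where t: "0 \<le> t" "t \<le> 1" "w = (1 - t) *\<^sub>R z i + t *\<^sub>R z (Suc i mod N)"
        by (auto simp: in_segment)
      have "w = u i * ((1 - t) *\<^sub>R Complex 1 (- tan \<phi>) + t *\<^sub>R Complex 1 (tan \<phi>))"
        using t(3) unfolding zS[OF that] by (simp add: z algebra_simps)
      also have "(1 - t) *\<^sub>R Complex 1 (- tan \<phi>) + t *\<^sub>R Complex 1 (tan \<phi>) = Complex 1 ((2 * t - 1) * tan \<phi>)"
        by (simp add: complex_eq_iff algebra_simps)
      finally have "w = u i * Complex 1 ((2 * t - 1) * tan \<phi>)" .
      moreover have "\<bar>(2 * t - 1) * tan \<phi>\<bar> \<le> tan \<phi>"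
      proof -
        have "\<bar>2 * t - 1\<bar> \<le> 1" using t by linarith
        then show ?thesis using mult_right_mono[of "\<bar>2 * t - 1\<bar>" 1 "tan \<phi>"] t0 by (simp add: abs_mult)
      qed
      ultimately show "w \<in> {u i * Complex 1 s |s. \<bar>s\<bar> \<le> tan \<phi>}" by blast
    next
      fix w assume "w \<in> {u i * Complex 1 s |s. \<bar>s\<bar> \<le> tan \<phi>}"
      then obtain s where s: "w = u i * Complex 1 s" "\<bar>s\<bar> \<le> tan \<phi>" by blast
      define t where "t = (s / tan \<phi> + 1) / 2"
      have t: "0 \<le> t" "t \<le> 1" using s t0 by (auto simp: t_def field_simps)
      have "Complex 1 s = (1 - t) *\<^sub>R Complex 1 (- tan \<phi>) + t *\<^sub>R Complex 1 (tan \<phi>)"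
        using t0 by (simp add: complex_eq_iff t_def field_simps)
      then have "w = u i * ((1 - t) *\<^sub>R Complex 1 (- tan \<phi>) + t *\<^sub>R Complex 1 (tan \<phi>))"
        using s(1) by simp
      also have "\<dots> = (1 - t) *\<^sub>R z i + t *\<^sub>R z (Suc i mod N)"
        unfolding zS[OF that] by (simp add: z algebra_simps)
      finally have "w = (1 - t) *\<^sub>R z i + t *\<^sub>R z (Suc i mod N)" .
      then show "w \<in> closed_segment (z i) (z (Suc i mod N))" using t unfolding in_segment by blast
    qed
  qed
  have line: "Re (w * cnj (u i)) = 1"
    if w: "w \<in> closed_segment (z i) (z (Suc i mod N))" and i: "i < N" for w i
  proof -
    obtain s where "w = u i * Complex 1 s" using w edge[OF i] by blast
    moreover have "u i * cnj (u i) = 1" using complex_norm_square[of "u i"] normu by simp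
    ultimately have "w * cnj (u i) = Complex 1 s" by (metis mult.assoc mult.commute mult.right_neutral)
    then show ?thesis by simp
  qed
  have u_inj: "u i \<noteq> u j" if "i < j" "j < N" for i j
  proof
    assume "u i = u j"
    \<comment> \<open>Since \<open>2 * m = N - 1\<close>, squaring the quotient gives a rotation by
      \<open>- 2 * pi * (j - i) / N\<close> up to full turns, which is not the identity for
      \<open>0 < j - i < N\<close>.\<close>
    then have "(u j / u i) ^ 2 = 1" using normu[of i] by auto
    then have "cis (2 * (2 * pi * m * j / N - 2 * pi * m * i / N)) = 1"
      by (simp only: u_def cis_divide Complex.DeMoivre of_nat_numeral)
    moreover have "2 * (2 * pi * m * j / N - 2 * pi * m * i / N) = 2 * pi * real (j - i) - 2 * pi * real (j - i) / N"
    proof -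
      have m2: "2 * real m = real N - 1" using N by simp
      have "2 * (2 * pi * m * j / N - 2 * pi * m * i / N) = 2 * pi * (2 * real m) * (real j - real i) / N"
        by (simp add: algebra_simps diff_divide_distrib)
      also have "\<dots> = 2 * pi * real (j - i) - 2 * pi * real (j - i) / N"
        unfolding m2 using that N(2) by (simp add: of_nat_diff field_simps)
      finally show ?thesis .
    qed
    ultimately have "cis (2 * pi * real (j - i) - 2 * pi * real (j - i) / N) = 1"
      by (simp only:)
    then have "cis (2 * pi * real (j - i)) * cis (- (2 * pi * real (j - i) / N)) = 1"
      by (simp only: cis_mult diff_conv_add_uminus)
    moreover have "cis (2 * pi * real (j - i)) = 1" using cis_multiple_2pi[of "real (j - i)"] by simp
    ultimately have "cos (2 * pi * real (j - i) / N) = 1"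
      by (metis cos_minus cis.sel(1) mult_1 one_complex.sel(1))
    then obtain k :: int where k: "2 * pi * real (j - i) / N = k * 2 * pi" using cos_one_2pi_int by auto
    then have "real (j - i) / N = k" using N(2) by (simp add: field_simps)
    moreover have "0 < real (j - i) / N" "real (j - i) / N < 1" using that by auto
    ultimately have "0 < real_of_int k" "real_of_int k < 1" by (simp_all only:)
    then show False by auto
  qed
  then have u_inj: "u i \<noteq> u j" if "i \<noteq> j" "i < N" "j < N" for i j
    using that by (metis linorder_neqE_nat)
  have two: "cnj w * (u i + u j) = 2"
    if "i < N" "j < N" "i \<noteq> j" "w \<in> closed_segment (z i) (z (Suc i mod N))" "w \<in> closed_segment (z j) (z (Suc j mod N))"
    for w i j
    using that by (intro on_two_tangents line normu u_inj)
  have once: "x = y" if "i < N" "j < N" "i \<noteq> j"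
      "x \<in> closed_segment (z i) (z (Suc i mod N))" "x \<in> closed_segment (z j) (z (Suc j mod N))"
      "y \<in> closed_segment (z i) (z (Suc i mod N))" "y \<in> closed_segment (z j) (z (Suc j mod N))" for i j x y
  proof -
    have "cnj x * (u i + u j) = cnj y * (u i + u j)" "u i + u j \<noteq> 0"
      using two[of i j x] two[of i j y] that by auto
    then show ?thesis by simp
  qed
  have triple: "x \<notin> closed_segment (z k) (z (Suc k mod N))" if "i < N" "j < N" "k < N" "i \<noteq> j" "j \<noteq> k" "i \<noteq> k"
      "x \<in> closed_segment (z i) (z (Suc i mod N))" "x \<in> closed_segment (z j) (z (Suc j mod N))" for i j k x
  proof
    assume "x \<in> closed_segment (z k) (z (Suc k mod N))"
    then have "cnj x * (u i + u j) = cnj x * (u i + u k)" "cnj x \<noteq> 0"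
      using two[of i j x] two[of i k x] that by auto
    then show False using u_inj[of j k] that by simp
  qed
  interpret closed_polygon N z
  proof (rule closed_polygonI)
    show "3 \<le> N" using m by (simp add: N_def)
  qed (fact triple once)+
  have meet: "edge i \<inter> edge j \<noteq> {}" if ij: "i < N" "j < N" for i j
  proof -
    define d where "d = int m * (int j - int i)"
    \<comment> \<open>\<open>k\<close> is chosen so that \<open>d - k * N\<close> is the
      representative of \<open>d\<close> modulo \<open>N\<close> between \<open>- m\<close> and
      \<open>m\<close>.\<close>
    define k where "k = (if d mod int N \<le> int m then d div int N else d div int N + 1)"
    define e where "e = d - k * int N"
    have e: "\<bar>e\<bar> \<le> int m"
    proof -
      have r: "0 \<le> d mod int N" "d mod int N < int N" using N(2) by auto
      have "e = (if d mod int N \<le> int m then d mod int N else d mod int N - int N)"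
        unfolding e_def k_def by (simp add: minus_div_mult_eq_mod[symmetric] algebra_simps)
      moreover have "int N = 2 * int m + 1" by (simp add: N_def)
      ultimately show ?thesis using r by (auto split: if_splits)
    qed
    define b where "b = pi * e / N"
    have b: "\<bar>b\<bar> \<le> \<phi>"
    proof -
      have "\<bar>b\<bar> = pi * real_of_int \<bar>e\<bar> / N" by (simp add: b_def abs_mult)
      also have "\<dots> \<le> pi * m / N" using e N(2) by (intro divide_right_mono mult_left_mono) auto
      finally show ?thesis by (simp add: \<phi>_def)
    qed
    have cosb: "cos b > 0" using b \<phi> by (intro cos_gt_zero_pi) auto
    have tanb: "\<bar>tan b\<bar> \<le> tan \<phi>"
    proof -
      have "tan b \<le> tan \<phi>" using b \<phi> by (intro tan_mono_le) auto
      moreover have "tan (- b) \<le> tan \<phi>" using b \<phi> by (intro tan_mono_le) auto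
      ultimately show ?thesis by (simp add: abs_le_iff)
    qed
    have "u j = u i * cis (2 * b)"
    proof -
      have "2 * pi * m * j / N = 2 * pi * m * i / N + 2 * b + 2 * pi * k"
      proof -
        have "real m * (real j - real i) = e + k * N"
          using e_def d_def by (metis add.commute diff_add_cancel of_int_add of_int_diff of_int_mult of_int_of_nat_eq)
        then have *: "real m * real j = real m * real i + e + k * N" by (simp add: algebra_simps)
        have "2 * pi * m * j / N = 2 * pi * (real m * real j) / N" by simp
        also have "\<dots> = 2 * pi * m * i / N + 2 * b + 2 * pi * k"
          unfolding * using N(2) by (simp add: b_def field_simps)
        finally show ?thesis .
      qed
      then have "u j = cis (2 * pi * m * i / N + 2 * b + 2 * pi * k)" by (simp add: u_def)
      also have "\<dots> = u i * cis (2 * b) * cis (2 * pi * k)" by (simp only: u_def cis_mult)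
      also have "cis (2 * pi * k) = 1" by (rule cis_multiple_2pi) auto
      finally show ?thesis by simp
    qed
    then have "u j * Complex 1 (- tan b) = u i * Complex 1 (tan b)"
      using cis_tan[of b] cosb by (simp add: mult.assoc)
    moreover have "u i * Complex 1 (tan b) \<in> edge i"
      unfolding edge_def edge[OF ij(1)] using tanb by blast
    moreover have "u j * Complex 1 (- tan b) \<in> edge j"
      unfolding edge_def edge[OF ij(2)] using tanb by (intro CollectI exI[of _ "- tan b"]) simp
    ultimately show ?thesis by auto
  qed
  have tr: no_triple_points
    using triple unfolding no_triple_points_def edge_def by blast
  have "N - 3 \<le> edge_degree i" if "i < N" for i
    using edge_degree_ge[OF tr that, of "{}"] meet that by simp
  then have "N * (N - 3) \<le> (\<Sum>i<N. edge_degree i)"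
    using sum_mono[of "{..<N}" "\<lambda>_. N - 3" edge_degree] by simp
  then have "real (card {C \<in> components (- (\<Union>i<N. edge i)). bounded C}) = max_regions N"
    using regions_maximal[OF tr] by (simp add: N_def)
  then show ?thesis unfolding edge_def using closed_polygon_axioms by blast
qed

section \<open>The extremal polygon with an even number of edges\<close>

text \<open>The equations give equal ratios of consecutive differences on both lines. For
  \<open>u\<close> this ratio is at most \<open>c - 1\<close>, as \<open>u3 \<le> c - 1\<close> and
  \<open>u2 - u1 \<ge> 1\<close>. For the powers it exceeds \<open>c - 1\<close>, as the numerator
  is at least \<open>(c - 1) * c ^ v2\<close> and the denominator is below
  \<open>c ^ v2\<close>.\<close>

lemma no_sorted_concurrency:
  fixes x c :: real and u1 u2 u3 v1 v2 v3 :: nat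
  assumes x: "0 < x" "x < 1" and c: "1 < c" "real u3 \<le> c - 1"
    and u: "u1 < u2" "u2 < u3" and v: "v2 < v3"
    and eq1: "(1 - x) * (real u2 - real u1) = x * (c ^ v2 - c ^ v1)"
    and eq2: "(1 - x) * (real u3 - real u2) = x * (c ^ v3 - c ^ v2)"
  shows False
proof -
  have "c * c ^ v2 \<le> c ^ v3"
    using v c power_increasing[of "Suc v2" v3 c] by simp
  then have "x * ((c - 1) * c ^ v2) \<le> x * (c ^ v3 - c ^ v2)"
    using x by (intro mult_left_mono) (auto simp: algebra_simps)
  also have "\<dots> = (1 - x) * (real u3 - real u2)" using eq2 by simp
  also have "\<dots> \<le> (1 - x) * ((c - 1) * (real u2 - real u1))"
  proof (intro mult_left_mono)
    have "(c - 1) * 1 \<le> (c - 1) * (real u2 - real u1)"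
      using c u by (intro mult_left_mono) auto
    moreover have "real u3 - real u2 \<le> c - 1" using c(2) by linarith
    ultimately show "real u3 - real u2 \<le> (c - 1) * (real u2 - real u1)" by (simp only: mult_1_right)
  qed (use x in simp)
  also have "\<dots> = (c - 1) * (x * (c ^ v2 - c ^ v1))" using eq1 by (simp add: mult_ac)
  also have "\<dots> < (c - 1) * (x * c ^ v2)" using c x by simp
  finally show False by (simp add: mult_ac)
qed

text \<open>Even corners lie on the line \<open>x = 0\<close> at the heights \<open>level N i\<close>, odd ones on \<open>x = 1\<close> at the heights
  \<open>- N ^ level N i\<close>; the exponential growth excludes triple points.\<close>

definition level :: "nat \<Rightarrow> nat \<Rightarrow> nat" where
  "level N i = min i (N - 1 - i)"

definition zigzag :: "nat \<Rightarrow> nat \<Rightarrow> complex" where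
  "zigzag N i = (if even i then Complex 0 (level N i) else Complex 1 (- (real N ^ level N i)))"

text \<open>Distinct indices on the same level add up to the odd number \<open>N - 1\<close>, so
  they have different parity and lie on different lines.\<close>

lemma level_inj:
  assumes "even N" "i < N" "j < N" "even i \<longleftrightarrow> even j" "level N i = level N j"
  shows "i = j"
proof (rule ccontr)
  assume "i \<noteq> j"
  then have "i + j + 1 = N" using assms(2,3,5) by (auto simp: level_def min_def split: if_splits)
  then show False using assms(1,4) by (metis even_add odd_one)
qed

text \<open>The level rises by one up to the middle and then falls by one; it is constant only along
  the middle edge and the closing edge. With lower level \<open>l\<close> the edge index is
  \<open>l\<close> on the way up and \<open>N - 2 - l\<close> on the way down.\<close>

lemma level_step:
  assumes "even N" "i < N" "level N i \<noteq> level N (Suc i mod N)"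
  shows "i = min (level N i) (level N (Suc i mod N)) \<or> i + min (level N i) (level N (Suc i mod N)) + 2 = N"
    and "level N i = Suc (level N (Suc i mod N)) \<or> level N (Suc i mod N) = Suc (level N i)"
  using assms by (auto simp: level_def mod_Suc min_def split: if_splits)

text \<open>Heights on the odd line are negated, so two edges cross when their levels are ordered
  the same way on both lines. Only the pair \<open>i\<close>, \<open>N - 2 - i\<close> can violate
  this, which costs each edge at most one crossing, and the middle and closing edges none.\<close>

lemma even_polygon:
  assumes ev: "even N" and N4: "N \<ge> 4"
  shows "\<exists>z. closed_polygon N z \<and>
    real (card {C \<in> components (- (\<Union>i<N. closed_segment (z i) (z (Suc i mod N)))). bounded C}) =
      max_regions N"
proof -
  define z where "z = zigzag N"
  define a where "a i = (if even i then i else Suc i mod N)" for i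
  define b where "b i = (if even i then Suc i mod N else i)" for i
  define u where "u i = level N (a i)" for i
  define v where "v i = level N (b i)" for i
  define f where "f i x = (1 - x) * real (u i) - x * real N ^ v i" for i x
  have par: "even (k mod N) \<longleftrightarrow> even k" for k using ev by (simp add: dvd_mod_iff)
  have ab: "a i < N" "b i < N" "even (a i)" "odd (b i)" if "i < N" for i
    using that N4 par by (auto simp: a_def b_def)
  have level_less: "level N i < N" for i using N4 by (auto simp: level_def)
  have edge: "closed_segment (z i) (z (Suc i mod N)) = {Complex x (f i x) |x. 0 \<le> x \<and> x \<le> 1}"
    if "i < N" for i
  proof -
    have "z (a i) = Complex 0 (u i)" "z (b i) = Complex 1 (- (real N ^ v i))"
      using ab[OF that] by (auto simp: z_def zigzag_def u_def v_def)
    moreover have "closed_segment (z i) (z (Suc i mod N)) = closed_segment (z (a i)) (z (b i))"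
      by (simp add: a_def b_def insert_commute)
    ultimately have "closed_segment (z i) (z (Suc i mod N)) =
        closed_segment (Complex 0 (u i)) (Complex 1 (- (real N ^ v i)))" by simp
    also have "closed_segment (Complex 0 (u i)) (Complex 1 (- (real N ^ v i))) =
        {Complex x (f i x) |x. 0 \<le> x \<and> x \<le> 1}"
      by (auto simp: closed_segment_def complex_eq_iff f_def algebra_simps)
    finally show ?thesis .
  qed
  have suc_inj: "i = j" if "Suc i mod N = Suc j mod N" "i < N" "j < N" for i j
    using that by (auto simp: mod_Suc split: if_splits)
  have u_eq: "a i = a j" if "u i = u j" "i < N" "j < N" for i j
    using level_inj[OF ev ab(1)[OF that(2)] ab(1)[OF that(3)]] ab(3)[OF that(2)] ab(3)[OF that(3)] that(1)
    by (simp add: u_def)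
  have v_eq: "b i = b j" if "v i = v j" "i < N" "j < N" for i j
    using level_inj[OF ev ab(2)[OF that(2)] ab(2)[OF that(3)]] ab(4)[OF that(2)] ab(4)[OF that(3)] that(1)
    by (simp add: v_def)
  have same_parity: "i = j" if "a i = a j \<or> b i = b j" "i < N" "j < N" "even i \<longleftrightarrow> even j" for i j
    using that suc_inj[of i j] by (auto simp: a_def b_def split: if_splits)
  have adjacent: "i = j \<or> Suc i mod N = j \<or> Suc j mod N = i" if "a i = a j \<or> b i = b j" "i < N" "j < N" for i j
    using that suc_inj[of i j] by (auto simp: a_def b_def split: if_splits)
  have N1: "1 < real N" using N4 by simp
  have pow_eq: "real N ^ k = real N ^ l \<longleftrightarrow> k = l" for k l
    by (rule power_inject_exp[OF N1])
  have pow_less: "real N ^ k < real N ^ l \<longleftrightarrow> k < l" for k l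
    by (rule power_strict_increasing_iff[OF N1])
  have uv_inj: "i = j" if ij: "u i = u j" "v i = v j" "i < N" "j < N" for i j
  proof (cases "even i \<longleftrightarrow> even j")
    case False
    have "a i = a j" "b i = b j" using u_eq[OF ij(1,3,4)] v_eq[OF ij(2,3,4)] .
    then have "Suc i mod N = j" "Suc j mod N = i" using False by (auto simp: a_def b_def split: if_splits)
    then show ?thesis using ij(3,4) N4 by (auto simp: mod_Suc split: if_splits)
  next
    case True
    then show ?thesis using same_parity[of i j] u_eq[OF ij(1,3,4)] ij(3,4) by simp
  qed
  have cross: "(1 - x) * (real (u i) - real (u j)) = x * (real N ^ v i - real N ^ v j)"
    if "f i x = f j x" for i j x
    using that by (simp add: f_def algebra_simps)
  have once: "p = q" if ij: "i < N" "j < N" "i \<noteq> j"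
      and p: "p \<in> closed_segment (z i) (z (Suc i mod N))" "p \<in> closed_segment (z j) (z (Suc j mod N))"
      and q: "q \<in> closed_segment (z i) (z (Suc i mod N))" "q \<in> closed_segment (z j) (z (Suc j mod N))" for i j p q
  proof -
    obtain x where x: "p = Complex x (f i x)" "f i x = f j x"
      using p unfolding edge[OF ij(1)] edge[OF ij(2)] by auto
    obtain y where y: "q = Complex y (f i y)" "f i y = f j y"
      using q unfolding edge[OF ij(1)] edge[OF ij(2)] by auto
    define du where "du = real (u i) - real (u j)"
    define dv where "dv = real N ^ v i - real N ^ v j"
    have "(1 - x) * du = x * dv" "(1 - y) * du = y * dv"
      using cross[OF x(2)] cross[OF y(2)] by (auto simp: du_def dv_def)
    \<comment> \<open>The abscissa of a common point solves a linear equation, which determines it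
      unless \<open>du\<close> and \<open>dv\<close> both vanish; distinct edges exclude
      that.\<close>
    then have *: "du = x * (du + dv)" "du = y * (du + dv)" by (auto simp: algebra_simps)
    then have "(x - y) * (du + dv) = 0" by (metis left_diff_distrib right_minus_eq)
    moreover have "du + dv \<noteq> 0 \<or> du = 0 \<and> dv = 0" using *(1) by auto
    moreover have "\<not> (du = 0 \<and> dv = 0)"
      using uv_inj[of i j] ij pow_eq by (auto simp: du_def dv_def)
    ultimately have "x = y" by auto
    then show ?thesis using x y by simp
  qed
  have triple: "p \<notin> closed_segment (z k) (z (Suc k mod N))" if ijk: "i < N" "j < N" "k < N" "i \<noteq> j" "j \<noteq> k" "i \<noteq> k"
      and p: "p \<in> closed_segment (z i) (z (Suc i mod N))" "p \<in> closed_segment (z j) (z (Suc j mod N))" for i j k p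
  proof
    assume pk: "p \<in> closed_segment (z k) (z (Suc k mod N))"
    obtain x where x: "0 \<le> x" "x \<le> 1" "f i x = f j x" "f i x = f k x"
      using p pk unfolding edge[OF ijk(1)] edge[OF ijk(2)] edge[OF ijk(3)] by auto
    \<comment> \<open>Distinct edges with a common end have indices of different parity, so no three
      edges share an end. A triple point therefore lies strictly between the two lines.\<close>
    have no3: "\<not> (a i = a j \<and> a j = a k)" "\<not> (b i = b j \<and> b j = b k)"
      using same_parity[of i j] same_parity[of j k] same_parity[of i k] ijk by argo+
    have x0: "x \<noteq> 0"
    proof
      assume "x = 0"
      then have "u i = u j" "u j = u k" using x by (auto simp: f_def)
      then show False using u_eq[of i j] u_eq[of j k] ijk no3(1) by simp
    qed
    have x1: "x \<noteq> 1"
    proof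
      assume "x = 1"
      then have "v i = v j" "v j = v k" using x pow_eq by (auto simp: f_def)
      then show False using v_eq[of i j] v_eq[of j k] ijk no3(2) by simp
    qed
    have x01: "0 < x" "x < 1" using x0 x1 x by auto
    \<comment> \<open>Passing a common point reverses the order of heights, and the negated heights
      on the odd line reverse it again. The edges through the point are thus sorted the same way by
      \<open>u\<close> and by \<open>v\<close>.\<close>
    have less: "u s < u t \<longleftrightarrow> v s < v t" if "f s x = f t x" for s t
    proof -
      have "0 < (1 - x) * (real (u t) - real (u s)) \<longleftrightarrow> 0 < x * (real N ^ v t - real N ^ v s)"
        using cross[of t x s] that by simp
      then show ?thesis using x01 pow_less by (simp add: zero_less_mult_iff)
    qed
    have neq: "u s \<noteq> u t" if "f s x = f t x" "s < N" "t < N" "s \<noteq> t" for s t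
      using less[of s t] less[of t s] that uv_inj[of s t] by auto
    have sorted: False if "f r x = f s x" "f s x = f t x" "u r < u s" "u s < u t" for r s t
    proof (rule no_sorted_concurrency[OF x01 _ _ that(3,4)])
      show "v s < v t" using less[of s t] that by simp
      show "(1 - x) * (real (u s) - real (u r)) = x * (real N ^ v s - real N ^ v r)"
        using cross[of s x r] that by simp
      show "(1 - x) * (real (u t) - real (u s)) = x * (real N ^ v t - real N ^ v s)"
        using cross[of t x s] that by simp
      have "u t + 1 \<le> N" using level_less[of "a t"] by (simp add: u_def)
      then show "real (u t) \<le> real N - 1" by linarith
    qed (use N4 in simp)
    have fjk: "f j x = f k x" using x(3,4) by simp
    have "u i \<noteq> u j" "u j \<noteq> u k" "u i \<noteq> u k"
      using neq[OF x(3) ijk(1,2,4)] neq[OF fjk ijk(2,3,5)] neq[OF x(4) ijk(1,3,6)] .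
    moreover have "\<not> (u i < u j \<and> u j < u k)" "\<not> (u i < u k \<and> u k < u j)" "\<not> (u j < u i \<and> u i < u k)"
      "\<not> (u j < u k \<and> u k < u i)" "\<not> (u k < u i \<and> u i < u j)" "\<not> (u k < u j \<and> u j < u i)"
      using sorted[of i j k] sorted[of i k j] sorted[of j i k] sorted[of j k i] sorted[of k i j] sorted[of k j i] x(3,4) fjk
      by argo+
    ultimately show False by linarith
  qed
  interpret closed_polygon N z
  proof (rule closed_polygonI)
    show "3 \<le> N" using N4 by simp
  qed (fact triple once)+
  have tr: no_triple_points
    using triple unfolding no_triple_points_def edge_def by blast
  have meet_less: "edge i \<inter> edge j \<noteq> {}" if ij: "i < N" "j < N" "u i < u j" "v i < v j" for i j
  proof -
    define du where "du = real (u j) - real (u i)"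
    define dv where "dv = real N ^ v j - real N ^ v i"
    have d: "du > 0" "dv > 0" using ij pow_less by (auto simp: du_def dv_def)
    define x where "x = du / (du + dv)"
    have x: "0 \<le> x" "x \<le> 1" using d by (auto simp: x_def)
    have "(1 - x) * du = x * dv" using d by (simp add: x_def field_simps)
    then have "f i x = f j x" by (simp add: f_def du_def dv_def algebra_simps)
    then have "Complex x (f i x) \<in> edge i \<inter> edge j"
      using x unfolding edge_def edge[OF ij(1)] edge[OF ij(2)] by auto
    then show ?thesis by blast
  qed
  \<comment> \<open>Levels at the two ends of an edge differ by at most one, so opposite orders
    force the level pairs \<open>(l, l + 1)\<close> and \<open>(l + 1, l)\<close>: the rising and
    the falling edge between two consecutive levels.\<close>
  have opposite: "i + j + 2 = N \<and> u i \<noteq> v i" if ij: "i < N" "j < N" "u i < u j" "v j < v i" for i j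
  proof -
    have uvi: "u i = Suc (v i) \<or> v i = Suc (u i) \<or> u i = v i" and uvj: "u j = Suc (v j) \<or> v j = Suc (u j) \<or> u j = v j"
      using level_step(2)[OF ev ij(1)] level_step(2)[OF ev ij(2)] by (auto simp: u_def v_def a_def b_def)
    then have *: "v i = Suc (u i)" "u j = Suc (u i)" "v j = u i" using ij(3,4) by auto
    have "i = u i \<or> i + u i + 2 = N" "j = u i \<or> j + u i + 2 = N"
      using level_step(1)[OF ev ij(1)] level_step(1)[OF ev ij(2)] *
      by (auto simp: u_def v_def a_def b_def min_def split: if_splits)
    moreover have "i \<noteq> j" using ij by auto
    ultimately show ?thesis using * by auto
  qed
  have meet: "edge i \<inter> edge j \<noteq> {}"
    if ij: "i < N" "j < N" "j \<noteq> i" "Suc i mod N \<noteq> j" "Suc j mod N \<noteq> i" and n: "i + j + 2 \<noteq> N \<or> u i = v i" for i j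
  proof -
    have "u i \<noteq> u j" "v i \<noteq> v j" using adjacent[of i j] u_eq[of i j] v_eq[of i j] ij by argo+
    moreover have "\<not> (u i < u j \<and> v j < v i)" using opposite[of i j] ij n by auto
    \<comment> \<open>Here \<open>opposite\<close> leaves only the case \<open>u i = v i\<close>,
      and then the levels of edge \<open>j\<close> would enclose this value strictly and differ by
      at least two.\<close>
    moreover have "\<not> (u j < u i \<and> v i < v j)"
    proof
      assume "u j < u i \<and> v i < v j"
      then have "j + i + 2 = N" "u i = v i" using opposite[of j i] ij n by auto
      then show False using \<open>u j < u i \<and> v i < v j\<close> level_step(2)[OF ev ij(2)]
        by (auto simp: u_def v_def a_def b_def split: if_splits)
    qed
    ultimately have "u i < u j \<and> v i < v j \<or> u j < u i \<and> v j < v i" by linarith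
    then show ?thesis using meet_less[OF ij(1,2)] meet_less[OF ij(2,1)] by (auto simp: Int_commute)
  qed
  have deg: "N - 4 \<le> edge_degree i" if "i < N" for i
  proof -
    \<comment> \<open>For the closing edge \<open>i = N - 1\<close> the truncated difference is 0,
      the index of an adjacent edge; the estimate remains valid.\<close>
    have "N - 3 - card {N - 2 - i} \<le> edge_degree i"
    proof (rule edge_degree_ge[OF tr that])
      fix j assume "j < N" "j \<noteq> i" "Suc i mod N \<noteq> j" "Suc j mod N \<noteq> i" "j \<notin> {N - 2 - i}"
      then show "edge i \<inter> edge j \<noteq> {}" using meet[OF that, of j] by fastforce
    qed simp
    then show ?thesis by simp
  qed
  have full: "N - 3 \<le> edge_degree i" if "i < N" "u i = v i" for i
  proof -
    have "N - 3 - card ({} :: nat set) \<le> edge_degree i"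
    proof (rule edge_degree_ge[OF tr that(1)])
      fix j assume "j < N" "j \<noteq> i" "Suc i mod N \<noteq> j" "Suc j mod N \<noteq> i"
      then show "edge i \<inter> edge j \<noteq> {}" using meet[OF that(1), of j] that(2) by blast
    qed simp
    then show ?thesis by simp
  qed
  \<comment> \<open>The middle edge joins the highest levels and the closing edge the lowest. They
    are the two inner common tangents of the sets of even and of odd corners, so these are the two
    edges that attain \<open>N - 3\<close>.\<close>
  define i0 where "i0 = N div 2 - 1"
  have i0: "i0 < N" "i0 \<noteq> N - 1" "i0 + i0 + 2 = N" using N4 ev by (auto simp: i0_def)
  have "level N i0 = level N (Suc i0 mod N)" "level N (N - 1) = level N (Suc (N - 1) mod N)"
    using i0 N4 by (auto simp: level_def mod_Suc min_def)
  then have uv: "u i0 = v i0" "u (N - 1) = v (N - 1)" by (auto simp: u_def v_def a_def b_def)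
  have "N * (N - 4) + 2 = (\<Sum>i<N. (N - 4) + of_bool (i \<in> {i0, N - 1}))"
  proof -
    have "(\<Sum>i<N. of_bool (i \<in> {i0, N - 1})) = (\<Sum>i\<in>{i0, N - 1}. 1 :: nat)"
      using i0(1) N4 by (intro sum.mono_neutral_cong_right) auto
    also have "\<dots> = 2" using i0(2) by simp
    finally show ?thesis by (simp only: sum.distrib sum_constant card_lessThan of_nat_id)
  qed
  also have "\<dots> \<le> (\<Sum>i<N. edge_degree i)"
  proof (rule sum_mono)
    fix i assume i: "i \<in> {..<N}"
    show "(N - 4) + of_bool (i \<in> {i0, N - 1}) \<le> edge_degree i"
    proof (cases "i \<in> {i0, N - 1}")
      case True
      then have "N - 3 \<le> edge_degree i" using full[of i] uv i by auto
      then show ?thesis using N4 True by simp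
    next
      case False
      then show ?thesis using deg[of i] i by simp
    qed
  qed
  finally have "real (card {C \<in> components (- (\<Union>i<N. edge i)). bounded C}) = max_regions N"
    using regions_maximal[OF tr] ev by simp
  then show ?thesis unfolding edge_def using closed_polygon_axioms by blast
qed

section \<open>Transfer to the real plane\<close>

lemma image_in_components:
  assumes "C \<in> components S" "continuous_on UNIV f" "continuous_on UNIV g"
    and gf: "\<And>x. g (f x) = x" and fg: "\<And>y. f (g y) = y"
  shows "f ` C \<in> components (f ` S)"
proof -
  have C: "C \<noteq> {}" "C \<subseteq> S" "connected C"
    using in_components_nonempty[OF assms(1)] in_components_subset[OF assms(1)]
      in_components_connected[OF assms(1)] .
  show ?thesis
    unfolding in_components_maximal
  proof (intro conjI allI impI)
    show "connected (f ` C)"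
      by (rule connected_continuous_image[OF continuous_on_subset[OF assms(2) subset_UNIV] C(3)])
    fix D assume D: "D \<noteq> {} \<and> f ` C \<subseteq> D \<and> D \<subseteq> f ` S \<and> connected D"
    have "connected (g ` D)"
      using connected_continuous_image[OF continuous_on_subset[OF assms(3) subset_UNIV]] D by blast
    moreover have "C \<subseteq> g ` D"
    proof
      fix x assume "x \<in> C"
      then have "g (f x) \<in> g ` D" using D by blast
      then show "x \<in> g ` D" by (simp only: gf)
    qed
    moreover have "g ` D \<subseteq> S"
    proof
      fix x assume "x \<in> g ` D"
      then obtain y where "y \<in> S" "x = g (f y)" using D by blast
      then show "x \<in> S" by (simp only: gf)
    qed
    ultimately have "g ` D = C"
      using components_maximal[OF assms(1), of "g ` D"] C(1) by blast
    moreover have "f ` g ` D = D" by (simp add: image_image fg)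
    ultimately show "D = f ` C" by simp
  qed (use C in auto)
qed

definition to_complex :: "real^2 \<Rightarrow> complex" where
  "to_complex v = Complex (v $ 1) (v $ 2)"

definition of_complex :: "complex \<Rightarrow> real^2" where
  "of_complex c = vector [Re c, Im c]"

lemma to_of_complex [simp]: "to_complex (of_complex c) = c"
  by (simp add: to_complex_def of_complex_def)

lemma of_to_complex [simp]: "of_complex (to_complex v) = v"
  by (simp add: to_complex_def of_complex_def vec_eq_iff forall_2)

lemma linear_to_complex: "linear to_complex"
  by (rule linearI) (auto simp: to_complex_def complex_eq_iff)

lemma linear_of_complex: "linear of_complex"
  by (rule linearI) (auto simp: of_complex_def vec_eq_iff forall_2)

lemma poly_edge_image:
  "to_complex ` poly_edge N p i = closed_segment (to_complex (p i)) (to_complex (p (Suc i mod N)))"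
  unfolding poly_edge_def by (rule closed_segment_linear_image[OF linear_to_complex, symmetric])

lemma card_bounded_regions_image:
  fixes p :: "nat \<Rightarrow> real^2" and N :: nat
  defines "z \<equiv> to_complex \<circ> p"
  defines "Rs \<equiv> {C \<in> components (- (\<Union>i<N. closed_segment (z i) (z (Suc i mod N)))). bounded C}"
  shows "finite (bounded_regions N p) \<longleftrightarrow> finite Rs" "card (bounded_regions N p) = card Rs"
proof -
  let ?S = "- (\<Union>i<N. poly_edge N p i)" and ?T = "- (\<Union>i<N. closed_segment (z i) (z (Suc i mod N)))"
  have bij: "bij to_complex" by (rule bij_betw_byWitness[of _ of_complex]) auto
  have T: "to_complex ` ?S = ?T"
    by (simp only: bij_image_Compl_eq[OF bij] image_UN poly_edge_image z_def comp_apply)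
  then have S: "of_complex ` ?T = ?S" unfolding T[symmetric] image_image by simp
  have cont: "continuous_on UNIV to_complex" "continuous_on UNIV of_complex"
    by (simp_all add: linear_continuous_on linear_conv_bounded_linear[symmetric] linear_to_complex linear_of_complex)
  have bd: "bounded (to_complex ` C)" if "bounded C" for C
    using that linear_to_complex by (simp add: bounded_linear_image linear_conv_bounded_linear)
  have bd': "bounded (of_complex ` C)" if "bounded C" for C
    using that linear_of_complex by (simp add: bounded_linear_image linear_conv_bounded_linear)
  have "bij_betw ((`) to_complex) (bounded_regions N p) Rs"
  proof (rule bij_betw_byWitness[where f' = "(`) of_complex"])
    show "(`) to_complex ` bounded_regions N p \<subseteq> Rs"
    proof (rule image_subsetI)
      fix C assume "C \<in> bounded_regions N p"
      then show "to_complex ` C \<in> Rs"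
        using image_in_components[OF _ cont, of C ?S] bd[of C] unfolding bounded_regions_def Rs_def T by simp
    qed
    show "(`) of_complex ` Rs \<subseteq> bounded_regions N p"
    proof (rule image_subsetI)
      fix C assume "C \<in> Rs"
      then show "of_complex ` C \<in> bounded_regions N p"
        using image_in_components[OF _ cont(2,1), of C ?T] bd'[of C] unfolding bounded_regions_def Rs_def S by simp
    qed
  qed (auto simp: image_image)
  then show "finite (bounded_regions N p) \<longleftrightarrow> finite Rs" "card (bounded_regions N p) = card Rs"
    by (rule bij_betw_finite, rule bij_betw_same_card)
qed

lemma admissible_polygon_iff:
  assumes "N \<ge> 3"
  shows "admissible_polygon N p \<longleftrightarrow> closed_polygon N (to_complex \<circ> p)"
proof -
  have inj: "inj to_complex" by (metis injI of_to_complex)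
  have mem: "x \<in> poly_edge N p i \<longleftrightarrow>
      to_complex x \<in> closed_segment (to_complex (p i)) (to_complex (p (Suc i mod N)))" for x i
    unfolding poly_edge_image[symmetric] using inj by (simp add: inj_image_mem_iff)
  have inj_on: "inj_on (to_complex \<circ> p) {..<N} \<longleftrightarrow> inj_on p {..<N}"
    using inj by (auto simp: inj_on_def)
  have mem': "of_complex x \<in> poly_edge N p i \<longleftrightarrow>
      x \<in> closed_segment ((to_complex \<circ> p) i) ((to_complex \<circ> p) (Suc i mod N))" for x i
    unfolding mem by simp
  show ?thesis
  proof
    assume A: "admissible_polygon N p"
    show "closed_polygon N (to_complex \<circ> p)"
    proof
      show "inj_on (to_complex \<circ> p) {..<N}" using A inj_on by (simp add: admissible_polygon_def)
    next
      fix i j x y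
      assume ij: "i < N" "j < N" "i \<noteq> j"
        and xy: "x \<in> closed_segment ((to_complex \<circ> p) i) ((to_complex \<circ> p) (Suc i mod N))"
          "x \<in> closed_segment ((to_complex \<circ> p) j) ((to_complex \<circ> p) (Suc j mod N))"
          "y \<in> closed_segment ((to_complex \<circ> p) i) ((to_complex \<circ> p) (Suc i mod N))"
          "y \<in> closed_segment ((to_complex \<circ> p) j) ((to_complex \<circ> p) (Suc j mod N))"
      have "of_complex x = of_complex y"
        using A ij xy[folded mem'] unfolding admissible_polygon_def by blast
      then show "x = y" by (metis to_of_complex)
    qed (rule assms)
  next
    assume "closed_polygon N (to_complex \<circ> p)"
    then interpret closed_polygon N "to_complex \<circ> p" .
    have "x = y" if "i < N" "j < N" "i \<noteq> j"
      "x \<in> poly_edge N p i" "x \<in> poly_edge N p j" "y \<in> poly_edge N p i" "y \<in> poly_edge N p j" for i j x y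
    proof -
      have "to_complex x = to_complex y"
        using edges_meet_once[of i j "to_complex x" "to_complex y"] that mem by simp
      then show ?thesis by (metis of_to_complex)
    qed
    then show "admissible_polygon N p"
      unfolding admissible_polygon_def using inj_on closed_polygon.inj[OF closed_polygon_axioms] by blast
  qed
qed

theorem theorem1:
  fixes N :: nat
  assumes "N \<ge> 3"
  shows "(\<forall>p. admissible_polygon N p \<longrightarrow>
            finite (bounded_regions N p) \<and> real (card (bounded_regions N p)) \<le> max_regions N)
         \<and> (\<exists>p. admissible_polygon N p \<and> real (card (bounded_regions N p)) = max_regions N)"
proof (intro conjI allI impI)
  fix p assume "admissible_polygon N p"
  then interpret closed_polygon N "to_complex \<circ> p" using admissible_polygon_iff[OF assms] by simp
  show "finite (bounded_regions N p)"
    unfolding card_bounded_regions_image(1) edge_def[symmetric] by (rule regions_count(1))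
  show "real (card (bounded_regions N p)) \<le> max_regions N"
    unfolding card_bounded_regions_image(2) edge_def[symmetric] by (rule regions_upper_bound)
next
  have "\<exists>z. closed_polygon N z \<and>
    real (card {C \<in> components (- (\<Union>i<N. closed_segment (z i) (z (Suc i mod N)))). bounded C}) = max_regions N"
  proof (cases "even N")
    case True
    then have "N \<ge> 4" using assms by (cases "N = 3") auto
    then show ?thesis using even_polygon[OF True] by simp
  next
    case False
    then obtain m where "N = 2 * m + 1" by (metis oddE)
    then show ?thesis using odd_polygon[of m] assms by auto
  qed
  then obtain z where z: "closed_polygon N z"
    "real (card {C \<in> components (- (\<Union>i<N. closed_segment (z i) (z (Suc i mod N)))). bounded C}) = max_regions N"
    by blast
  have "to_complex \<circ> (of_complex \<circ> z) = z" by auto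
  then have "admissible_polygon N (of_complex \<circ> z)" "real (card (bounded_regions N (of_complex \<circ> z))) = max_regions N"
    using z by (simp_all only: admissible_polygon_iff[OF assms] card_bounded_regions_image(2))
  then show "\<exists>p. admissible_polygon N p \<and> real (card (bounded_regions N p)) = max_regions N" by blast
qed

end
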